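(* Let $l_\sigma=\gamma\circ c_\sigma\circ\lambda$ be the automorphism of $F(u,v)\rtimes_\theta(\mathbb{Z}\rtimes\mathbb{Z})\cong P_2(\mathbb{K}^2)$ corresponding to conjugation by $\sigma$, as defined in the context. For all $r,s,m,n\in\mathbb{Z}$, we have: (1) $l_\sigma(u^r;0,0)=((Bu^{-1})^{r}B^{-r};r,0)$. (2) $l_\sigma(v^s;0,0)=((uv)^{-s}(uB)^{\delta_s};0,s)$. (3) $l_\sigma(B;0,0)=(B;0,0)$. (4) $l_\sigma(\mathbb{1};m,0)=(\mathbb{1};m,0)$. (5) $l_\sigma(\mathbb{1};0,n)=(B^{\delta_n};0,n)$.
   Context: $\mathbb{K}^2$ is the Klein bottle. Its full $2$-string braid group $B_2(\mathbb{K}^2)$ has generators $a_1,a_2,\sigma$ and relations $\sigma^{-1}a_r\sigma^{-1}a_r=a_r\sigma^{-1}a_r\sigma$ ($r\in\{1,2\}$), $\sigma^{-1}a_1\sigma a_2=a_2\sigma^{-1}a_1\sigma$, $a_1^2a_2^2=\sigma^2$. The pure braid group $P_2(\mathbb{K}^2)$ is the kernel of the homomorphism $B_2(\mathbb{K}^2)\to\mathbb{Z}_2$ sending $\sigma\mapsto\overline1$, $a_1,a_2\mapsto\overline0$; it is generated by $a_1,a_2$, $b_r=\sigma a_r\sigma^{-1}$ ($r\in\{1,2\}$) and $B=\sigma^2$. Let $c_\sigma:P_2(\mathbb{K}^2)\to P_2(\mathbb{K}^2)$, $c_\sigma(g)=\sigma g\sigma^{-1}$; thus $c_\sigma(B)=B$,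 $c_\sigma(a_i)=b_i$, $c_\sigma(b_j)=Ba_jB^{-1}$. $\mathbb{Z}\rtimes\mathbb{Z}$ is $\mathbb{Z}\times\mathbb{Z}$ with product $(r_1,s_1)(r_2,s_2)=(r_1+(-1)^{s_1}r_2,s_1+s_2)$. $F(u,v)$ is the free group on $\{u,v\}$, with trivial element $\mathbb{1}$; in it $B=uvuv^{-1}$. Let $\delta_n=0$ for $n$ even and $\delta_n=1$ for $n$ odd. The action $\theta:\mathbb{Z}\rtimes\mathbb{Z}\to\mathrm{Aut}(F(u,v))$ is $$\theta(m,n)(u)=B^{m-\delta_n}u^{(-1)^n}B^{-m+\delta_n},\quad\theta(m,n)(v)=B^mvu^{-2m}B^{-m+\delta_n},$$ and satisfies $\theta(m,n)(B)=B^{(-1)^n}$. Elements of the semi-direct product are written $(w;m,n)$, with product $(w;g)(w';g')=(w\,\theta(g)(w');gg')$. The isomorphism $\lambda:F(u,v)\rtimes_\theta(\mathbb{Z}\rtimes\mathbb{Z})\to P_2(\mathbb{K}^2)$ is given by $(u;0,0)\mapsto b_1b_2$, $(v;0,0)\mapsto b_2^{-1}$, $(\mathbb{1};1,0)\mapsto b_1a_1b_2a_2$, $(\mathbb{1};0,1)\mapsto a_2^{-1}b_2^{-1}$ (so $(B;0,0)\mapsto B$), and $\gamma=\lambda^{-1}$, so that $\gamma(a_1)=(v^{-1}u^{-1};1,1)$, $\gamma(a_2)=(v;0,-1)$, $\gamma(b_1)=(uv;0,0)$, $\gamma(b_2)=(v^{-1};0,0)$, $\gamma(B)=(B;0,0)$.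 *)

theory Defs
  imports "HOL-Algebra.Elementary_Groups"
begin

section \<open>Groups given by generators and relations\<close>

text \<open>A word is a list of letters; \<open>(x, True)\<close> stands for the generator \<open>x\<close> and
  \<open>(x, False)\<close> for its inverse. All elements of the type \<open>'a\<close> are generators, and a
  relation \<open>l = r\<close> is the pair of words \<open>(l, r)\<close>.\<close>

type_synonym 'a word = "('a \<times> bool) list"

inductive pres_step :: "('a word \<times> 'a word) set \<Rightarrow> 'a word \<Rightarrow> 'a word \<Rightarrow> bool"
  for R :: "('a word \<times> 'a word) set" where
  cancel: "pres_step R (p @ [(x, b), (x, \<not> b)] @ q) (p @ q)"
| relation: "(l, r) \<in> R \<Longrightarrow> pres_step R (p @ l @ q) (p @ r @ q)"

definition word_class :: "('a word \<times> 'a word) set \<Rightarrow> 'a word \<Rightarrow> 'a word set" where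
  "word_class R w = {w'. equivclp (pres_step R) w w'}"

definition presented_group :: "('a word \<times> 'a word) set \<Rightarrow> 'a word set monoid" where
  "presented_group R =
     \<lparr>carrier = range (word_class R),
      monoid.mult = (\<lambda>P Q. \<Union>x\<in>P. \<Union>y\<in>Q. word_class R (x @ y)),
      one = word_class R []\<rparr>"

definition gen_class :: "('a word \<times> 'a word) set \<Rightarrow> 'a \<Rightarrow> 'a word set" where
  "gen_class R x = word_class R [(x, True)]"

fun eval_word :: "('b, 'm) monoid_scheme \<Rightarrow> ('a \<Rightarrow> 'b) \<Rightarrow> 'a word \<Rightarrow> 'b" where
  "eval_word G f [] = \<one>\<^bsub>G\<^esub>"
| "eval_word G f ((x, b) # w) =
     (if b then f x else inv\<^bsub>G\<^esub> f x) \<otimes>\<^bsub>G\<^esub> eval_word G f w"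

text \<open>The homomorphism from a presented group to \<open>G\<close> sending each generator \<open>x\<close> to \<open>f x\<close>
  (meaningful when \<open>f\<close> respects the relations).\<close>

definition pres_lift :: "('b, 'm) monoid_scheme \<Rightarrow> ('a \<Rightarrow> 'b) \<Rightarrow> 'a word set \<Rightarrow> 'b" where
  "pres_lift G f P = the_elem (eval_word G f ` P)"


section \<open>The braid group and the pure braid group of the Klein bottle\<close>

datatype braid_gen = Ga1 | Ga2 | Gsigma

definition klein_relations :: "(braid_gen word \<times> braid_gen word) set" where
  "klein_relations =
     (let a1 = [(Ga1, True)]; a2 = [(Ga2, True)];
          s = [(Gsigma, True)]; s' = [(Gsigma, False)]
      in {(s' @ a1 @ s' @ a1, a1 @ s' @ a1 @ s),
          (s' @ a2 @ s' @ a2, a2 @ s' @ a2 @ s),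
          (s' @ a1 @ s @ a2, a2 @ s' @ a1 @ s),
          (a1 @ a1 @ a2 @ a2, s @ s)})"

definition B2K :: "braid_gen word set monoid" where
  "B2K = presented_group klein_relations"

definition a1K :: "braid_gen word set" where "a1K = gen_class klein_relations Ga1"
definition a2K :: "braid_gen word set" where "a2K = gen_class klein_relations Ga2"
definition sigmaK :: "braid_gen word set" where "sigmaK = gen_class klein_relations Gsigma"

definition b1K :: "braid_gen word set" where
  "b1K = sigmaK \<otimes>\<^bsub>B2K\<^esub> a1K \<otimes>\<^bsub>B2K\<^esub> inv\<^bsub>B2K\<^esub> sigmaK"
definition b2K :: "braid_gen word set" where
  "b2K = sigmaK \<otimes>\<^bsub>B2K\<^esub> a2K \<otimes>\<^bsub>B2K\<^esub> inv\<^bsub>B2K\<^esub> sigmaK"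

definition braid_parity :: "braid_gen word set \<Rightarrow> int" where
  "braid_parity = pres_lift (integer_mod_group 2) (\<lambda>x. if x = Gsigma then 1 else 0)"

definition P2K :: "braid_gen word set monoid" where
  "P2K = B2K\<lparr>carrier := kernel B2K (integer_mod_group 2) braid_parity\<rparr>"

definition c_sigma :: "braid_gen word set \<Rightarrow> braid_gen word set" where
  "c_sigma = (\<lambda>g\<in>carrier P2K. sigmaK \<otimes>\<^bsub>B2K\<^esub> g \<otimes>\<^bsub>B2K\<^esub> inv\<^bsub>B2K\<^esub> sigmaK)"


section \<open>The semi-direct product\<close>

definition ZxZ :: "(int \<times> int) monoid" where
  "ZxZ = \<lparr>carrier = UNIV,
          monoid.mult = (\<lambda>(r1, s1) (r2, s2). (r1 + (if even s1 then r2 else - r2), s1 + s2)),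
          one = (0, 0)\<rparr>"

datatype free_gen = Gu | Gv

definition Fuv :: "free_gen word set monoid" where
  "Fuv = presented_group {}"

definition uF :: "free_gen word set" where "uF = gen_class {} Gu"
definition vF :: "free_gen word set" where "vF = gen_class {} Gv"

definition BF :: "free_gen word set" where
  "BF = uF \<otimes>\<^bsub>Fuv\<^esub> vF \<otimes>\<^bsub>Fuv\<^esub> uF \<otimes>\<^bsub>Fuv\<^esub> inv\<^bsub>Fuv\<^esub> vF"

definition delta :: "int \<Rightarrow> int" where
  "delta n = (if even n then 0 else 1)"

fun theta :: "int \<times> int \<Rightarrow> free_gen word set \<Rightarrow> free_gen word set" where
  "theta (m, n) =
     pres_lift Fuv (\<lambda>x. case x of
        Gu \<Rightarrow> BF [^]\<^bsub>Fuv\<^esub> (m - delta n) \<otimes>\<^bsub>Fuv\<^esub> uF [^]\<^bsub>Fuv\<^esub> (if even n then 1 else - 1 :: int)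
              \<otimes>\<^bsub>Fuv\<^esub> BF [^]\<^bsub>Fuv\<^esub> (- m + delta n)
      | Gv \<Rightarrow> BF [^]\<^bsub>Fuv\<^esub> m \<otimes>\<^bsub>Fuv\<^esub> vF \<otimes>\<^bsub>Fuv\<^esub> uF [^]\<^bsub>Fuv\<^esub> (- 2 * m)
              \<otimes>\<^bsub>Fuv\<^esub> BF [^]\<^bsub>Fuv\<^esub> (- m + delta n))"

definition semidirect ::
  "('a, 'm) monoid_scheme \<Rightarrow> ('b, 'n) monoid_scheme \<Rightarrow> ('b \<Rightarrow> 'a \<Rightarrow> 'a) \<Rightarrow> ('a \<times> 'b) monoid" where
  "semidirect N H \<theta> =
     \<lparr>carrier = carrier N \<times> carrier H,
      monoid.mult = (\<lambda>(w, g) (w', g'). (w \<otimes>\<^bsub>N\<^esub> \<theta> g w', g \<otimes>\<^bsub>H\<^esub> g')),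
      one = (\<one>\<^bsub>N\<^esub>, \<one>\<^bsub>H\<^esub>)\<rparr>"

type_synonym sd_elem = "free_gen word set \<times> int \<times> int"

definition SD :: "sd_elem monoid" where
  "SD = semidirect Fuv ZxZ theta"


section \<open>Conjugation by \<open>\<sigma>\<close> in the semi-direct product\<close>

text \<open>The four prescribed elements generate \<open>SD\<close>, so they determine a homomorphism uniquely on
  \<open>carrier SD\<close>; extensionality fixes the (irrelevant) values elsewhere.\<close>

definition lambda_iso :: "sd_elem \<Rightarrow> braid_gen word set" where
  "lambda_iso = (THE f. f \<in> extensional (carrier SD) \<and> f \<in> iso SD P2K \<and>
     f (uF, 0, 0) = b1K \<otimes>\<^bsub>B2K\<^esub> b2K \<and>
     f (vF, 0, 0) = inv\<^bsub>B2K\<^esub> b2K \<and>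
     f (\<one>\<^bsub>Fuv\<^esub>, 1, 0) = b1K \<otimes>\<^bsub>B2K\<^esub> a1K \<otimes>\<^bsub>B2K\<^esub> b2K \<otimes>\<^bsub>B2K\<^esub> a2K \<and>
     f (\<one>\<^bsub>Fuv\<^esub>, 0, 1) = inv\<^bsub>B2K\<^esub> a2K \<otimes>\<^bsub>B2K\<^esub> inv\<^bsub>B2K\<^esub> b2K)"

definition gamma_iso :: "braid_gen word set \<Rightarrow> sd_elem" where
  "gamma_iso = inv_into (carrier SD) lambda_iso"

definition l_sigma :: "sd_elem \<Rightarrow> sd_elem" where
  "l_sigma = gamma_iso \<circ> c_sigma \<circ> lambda_iso"

end

theory Submission
  imports Defs
begin

text \<open>
  Since \<open>\<lambda>\<close> and \<open>\<gamma>\<close> are mutually inverse, \<open>l\<^sub>\<sigma>(p) = q\<close> holds as soon as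
  \<open>\<sigma> \<lambda>(p) = \<lambda>(q) \<sigma>\<close> in the braid group. With \<open>u = b\<^sub>1b\<^sub>2\<close>, \<open>v = b\<^sub>2\<^sup>-\<^sup>1\<close>, \<open>X = b\<^sub>1a\<^sub>1b\<^sub>2a\<^sub>2\<close> and
  \<open>Y = a\<^sub>2\<^sup>-\<^sup>1b\<^sub>2\<^sup>-\<^sup>1\<close>, all five formulas are powers of
  \<open>\<sigma>u = (Bu\<^sup>-\<^sup>1)(B\<^sup>-\<^sup>1X)\<sigma>\<close>, \<open>\<sigma>v = v\<^sup>-\<^sup>1BY\<sigma>\<close>, \<open>\<sigma>B = B\<sigma>\<close>, \<open>\<sigma>X = X\<sigma>\<close> and \<open>\<sigma>Y = BY\<sigma>\<close>. In the
  first product the two factors commute, which gives \<open>(Bu\<^sup>-\<^sup>1)\<^sup>rB\<^sup>-\<^sup>rX\<^sup>r\<close>; in the second and the last one the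
  squares \<open>(v\<^sup>-\<^sup>1BY)\<^sup>2 = (uv)\<^sup>-\<^sup>2Y\<^sup>2\<close> and \<open>(BY)\<^sup>2 = Y\<^sup>2\<close> are simpler than their roots, and
  \<open>Y\<^sup>2\<close> commutes with \<open>u\<close>, \<open>v\<close> and \<open>B\<close>, which accounts for the dependence
  on the parity \<open>\<delta>\<close> (lemmas \<open>s_u_pow\<close>, \<open>s_v_pow\<close>, \<open>s_Y_pow\<close>).

  The larger part of the work is that \<open>\<lambda>\<close> exists, so that its definite description denotes
  something. The relations of the braid group become transparent in terms of \<open>x = b\<^sub>1a\<^sub>1\<close> and
  \<open>y = b\<^sub>2a\<^sub>2\<close>: both invert \<open>B\<close>, they normalize the subgroup generated by \<open>b\<^sub>1\<close> and \<open>b\<^sub>2\<close>, and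
  \<open>x\<^sup>2y\<^sup>2 = 1\<close>, the relation of the fundamental group of the Klein bottle. As \<open>X = xy\<close> and
  \<open>Y = y\<^sup>-\<^sup>1\<close>, these elements act on \<open>u\<close> and \<open>v\<close> as \<open>\<theta>\<close> prescribes, and \<open>YXY\<^sup>-\<^sup>1 = X\<^sup>-\<^sup>1\<close>;
  hence \<open>(w; m, n) \<mapsto> \<phi>(w)X\<^sup>mY\<^sup>n\<close> is a homomorphism (lemma \<open>lam_hom\<close>).

  It is injective because the braid group is represented in the wreath product of the
  semi-direct product with the group of order two. This is the representation induced from the
  pure braid group: \<open>\<sigma>\<close> exchanges the two cosets and a pure braid \<open>g\<close> goes to the pair
  \<open>(\<gamma>(g), \<gamma>(\<sigma>g\<sigma>\<^sup>-\<^sup>1))\<close>. It is defined on generators, and what has to be checked is only that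
  finitely many identities hold in the semi-direct product; the first component then is a left
  inverse of \<open>\<lambda>\<close> (lemma \<open>covers_lam\<close>). It is surjective because the image of
  \<open>\<lambda>\<close> and its translate by \<open>\<sigma>\<close> are permuted by right multiplication with generators, so that they
  exhaust the braid group, and the parity of \<open>\<sigma>\<close> separates them (lemmas \<open>B2K_cosets\<close> and
  \<open>carrier_P2K\<close>). Finally, homomorphisms agreeing on the four prescribed elements are equal
  (lemma \<open>generate_SD\<close>).
\<close>

section \<open>Groups given by generators and relations\<close>

lemma word_class_eq_iff: "word_class R v = word_class R w \<longleftrightarrow> equivclp (pres_step R) v w"
proof
  assume "word_class R v = word_class R w"
  then have "w \<in> word_class R v"
    by (auto simp: word_class_def)
  then show "equivclp (pres_step R) v w"
    by (simp add: word_class_def)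
next
  assume "equivclp (pres_step R) v w"
  then show "word_class R v = word_class R w"
    unfolding word_class_def by (blast intro: equivclp_sym equivclp_trans)
qed

lemma mem_word_class_iff: "w \<in> word_class R v \<longleftrightarrow> word_class R w = word_class R v"
  unfolding word_class_eq_iff by (auto simp: word_class_def intro: equivclp_sym)

lemma self_mem_word_class [simp]: "w \<in> word_class R w"
  by (simp add: mem_word_class_iff)

lemma pres_step_context:
  assumes "pres_step R x y"
  shows "pres_step R (p @ x @ q) (p @ y @ q)"
  using assms
proof cases
  case (cancel p' a b q')
  then show ?thesis
    using pres_step.cancel[of R "p @ p'" a b "q' @ q"] by simp
next
  case (relation l r p' q')
  then show ?thesis
    using pres_step.relation[of l r R "p @ p'" "q' @ q"] by simp
qed

lemma word_class_context:
  assumes "word_class R x = word_class R y"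
  shows "word_class R (p @ x @ q) = word_class R (p @ y @ q)"
  using assms unfolding word_class_eq_iff
proof (induction rule: equivclp_induct)
  case (step y z)
  then show ?case
    by (blast intro: equivclp_trans[OF step.IH] pres_step_context r_into_equivclp equivclp_sym)
qed simp

lemma word_class_append:
  assumes "word_class R x = word_class R x'" "word_class R y = word_class R y'"
  shows "word_class R (x @ y) = word_class R (x' @ y')"
  using word_class_context[OF assms(1), of "[]" y] word_class_context[OF assms(2), of x' "[]"]
  by simp

lemma carrier_presented_group: "carrier (presented_group R) = range (word_class R)"
  by (simp add: presented_group_def)

lemma word_class_in_carrier [simp, intro]: "word_class R w \<in> carrier (presented_group R)"
  by (simp add: carrier_presented_group)

lemma one_presented_group: "\<one>\<^bsub>presented_group R\<^esub> = word_class R []"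
  by (simp add: presented_group_def)

text \<open>
  The union in the definition of the product runs over all representatives; it collapses because
  all products of representatives are equivalent.
\<close>

lemma mult_presented_group:
  "word_class R x \<otimes>\<^bsub>presented_group R\<^esub> word_class R y = word_class R (x @ y)"
proof -
  have "(\<Union>x'\<in>word_class R x. \<Union>y'\<in>word_class R y. word_class R (x' @ y')) =
      (\<Union>x'\<in>word_class R x. \<Union>y'\<in>word_class R y. word_class R (x @ y))"
    by (intro SUP_cong refl word_class_append) (simp_all add: mem_word_class_iff)
  moreover have "word_class R x \<noteq> {}" "word_class R y \<noteq> {}"
    using self_mem_word_class by blast+
  ultimately have "(\<Union>x'\<in>word_class R x. \<Union>y'\<in>word_class R y. word_class R (x' @ y')) = word_class R (x @ y)"
    by simp
  then show ?thesis
    by (simp add: presented_group_def)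
qed

lemma word_class_cancel: "word_class R ([(x, b), (x, \<not> b)] @ w) = word_class R w"
  unfolding word_class_eq_iff
  using pres_step.cancel[of R "[]" x b w] by (simp add: r_into_equivclp)

lemma word_class_inverse:
  "word_class R (rev (map (\<lambda>(x, b). (x, \<not> b)) w) @ w) = word_class R []"
proof (induction w)
  case (Cons l w)
  obtain x b where l: "l = (x, b)" by (cases l)
  have "word_class R (rev (map (\<lambda>(x, b). (x, \<not> b)) w) @ ([(x, \<not> b), (x, \<not> \<not> b)] @ w) @ [])
      = word_class R (rev (map (\<lambda>(x, b). (x, \<not> b)) w) @ w @ [])"
    by (rule word_class_context[OF word_class_cancel])
  then show ?case
    using Cons.IH by (simp add: l)
qed simp

lemma group_presented_group: "group (presented_group R)"
proof (rule groupI)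
  fix P assume "P \<in> carrier (presented_group R)"
  then obtain w where "P = word_class R w"
    by (auto simp: carrier_presented_group)
  then have "word_class R (rev (map (\<lambda>(x, b). (x, \<not> b)) w)) \<otimes>\<^bsub>presented_group R\<^esub> P
      = \<one>\<^bsub>presented_group R\<^esub>"
    by (simp only: mult_presented_group word_class_inverse one_presented_group)
  then show "\<exists>Q\<in>carrier (presented_group R). Q \<otimes>\<^bsub>presented_group R\<^esub> P = \<one>\<^bsub>presented_group R\<^esub>"
    by blast
qed (auto simp: carrier_presented_group mult_presented_group one_presented_group)

lemma gen_class_in_carrier [simp, intro]: "gen_class R x \<in> carrier (presented_group R)"
  by (simp add: gen_class_def)

lemma inv_gen_class: "inv\<^bsub>presented_group R\<^esub> gen_class R x = word_class R [(x, False)]"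
proof (rule group.inv_equality[OF group_presented_group])
  show "word_class R [(x, False)] \<otimes>\<^bsub>presented_group R\<^esub> gen_class R x = \<one>\<^bsub>presented_group R\<^esub>"
    using word_class_cancel[of R x False "[]"]
    by (simp add: gen_class_def mult_presented_group one_presented_group)
qed auto

lemma word_class_Cons:
  "word_class R ((x, b) # w) =
     (if b then gen_class R x else inv\<^bsub>presented_group R\<^esub> gen_class R x)
       \<otimes>\<^bsub>presented_group R\<^esub> word_class R w"
  by (simp add: inv_gen_class mult_presented_group) (simp add: gen_class_def mult_presented_group)

lemma eval_word_gen_class: "eval_word (presented_group R) (gen_class R) w = word_class R w"
proof (induction w)
  case (Cons l w)
  then show ?case
    by (cases l) (simp only: eval_word.simps word_class_Cons)
qed (simp add: one_presented_group)

lemma eval_word_relation: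
  assumes "(l, r) \<in> R"
  shows "eval_word (presented_group R) (gen_class R) l = eval_word (presented_group R) (gen_class R) r"
  unfolding eval_word_gen_class word_class_eq_iff
  using pres_step.relation[OF assms, of "[]" "[]"] by (simp add: r_into_equivclp)

lemma generate_presented_group:
  "generate (presented_group R) (range (gen_class R)) = carrier (presented_group R)"
proof -
  have "word_class R w \<in> generate (presented_group R) (range (gen_class R))" for w
  proof (induction w)
    case Nil
    then show ?case
      using generate.one[of "presented_group R"] by (simp add: one_presented_group)
  next
    case (Cons l w)
    then show ?case
      by (cases l) (simp add: word_class_Cons generate.incl generate.inv generate.eng)
  qed
  then show ?thesis
    using group.generate_incl[OF group_presented_group, of "range (gen_class R)" R]
    by (auto simp: carrier_presented_group gen_class_def)
qed

context group
begin

lemma eval_word_closed: "range f \<subseteq> carrier G \<Longrightarrow> eval_word G f w \<in> carrier G"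
  by (induction w) (auto simp: subset_iff)

lemma eval_word_append:
  assumes "range f \<subseteq> carrier G"
  shows "eval_word G f (v @ w) = eval_word G f v \<otimes> eval_word G f w"
proof (induction v)
  case (Cons l v)
  have "f (fst l) \<in> carrier G"
    using assms by blast
  with Cons show ?case
    by (cases l) (simp add: m_assoc eval_word_closed[OF assms])
qed (simp add: eval_word_closed[OF assms])

text \<open>
  The von Dyck property at the level of a single rewriting step: a cancellation disappears in
  every group, and an application of a relation disappears where the relation holds.
\<close>

lemma eval_word_pres_step:
  assumes f: "range f \<subseteq> carrier G"
    and R: "\<And>l r. (l, r) \<in> R \<Longrightarrow> eval_word G f l = eval_word G f r"
    and "pres_step R v w"
  shows "eval_word G f v = eval_word G f w"
  using assms(3)
proof cases
  case (cancel p x b q)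
  have "f x \<in> carrier G"
    using f by blast
  then have "eval_word G f [(x, b), (x, \<not> b)] = \<one>"
    by simp
  then show ?thesis
    unfolding cancel eval_word_append[OF f] by (simp only: l_one eval_word_closed[OF f])
next
  case (relation l r p q)
  then show ?thesis
    by (simp add: eval_word_append[OF f] R)
qed

lemma pres_lift_word_class:
  assumes f: "range f \<subseteq> carrier G"
    and R: "\<And>l r. (l, r) \<in> R \<Longrightarrow> eval_word G f l = eval_word G f r"
  shows "pres_lift G f (word_class R w) = eval_word G f w"
proof -
  have "eval_word G f v = eval_word G f w" if "equivclp (pres_step R) w v" for v
    using that
  proof (induction rule: equivclp_induct)
    case (step y z)
    have "eval_word G f y = eval_word G f z"
      using step.hyps(2) eval_word_pres_step[OF f R, where v = y and w = z] eval_word_pres_step[OF f R, where v = z and w = y]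
      by (elim disjE) simp_all
    then show ?case
      using step.IH by simp
  qed simp
  then have "eval_word G f ` word_class R w \<subseteq> {eval_word G f w}"
    unfolding word_class_def by blast
  then have "eval_word G f ` word_class R w = {eval_word G f w}"
    using self_mem_word_class[of w R] by blast
  then show ?thesis
    by (simp add: pres_lift_def)
qed

lemma pres_lift_hom:
  assumes f: "range f \<subseteq> carrier G"
    and R: "\<And>l r. (l, r) \<in> R \<Longrightarrow> eval_word G f l = eval_word G f r"
  shows "pres_lift G f \<in> hom (presented_group R) G"
  by (rule homI)
    (auto simp: carrier_presented_group mult_presented_group pres_lift_word_class[OF assms]
      eval_word_append[OF f] eval_word_closed[OF f])

lemma pres_lift_gen_class:
  assumes f: "range f \<subseteq> carrier G"
    and R: "\<And>l r. (l, r) \<in> R \<Longrightarrow> eval_word G f l = eval_word G f r"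
  shows "pres_lift G f (gen_class R x) = f x"
proof -
  have "f x \<in> carrier G"
    using f by blast
  then show ?thesis
    by (simp add: gen_class_def pres_lift_word_class[OF assms])
qed

end

lemma hom_eq_on_generators:
  assumes "group G" "group H" and h: "h \<in> hom G H" and k: "k \<in> hom G H"
    and S: "S \<subseteq> carrier G" and eq: "\<And>x. x \<in> S \<Longrightarrow> h x = k x"
    and x: "x \<in> generate G S"
  shows "h x = k x"
proof -
  interpret h: group_hom G H h
    using assms(1-3) by (simp add: group_hom_def group_hom_axioms_def)
  interpret k: group_hom G H k
    using assms(1,2,4) by (simp add: group_hom_def group_hom_axioms_def)
  show ?thesis
    using x
  proof induction
    case (inv a)
    then show ?case
      using S by (auto simp: eq subset_iff)
  next
    case (eng a b)
    then show ?case
      using h.G.generate_in_carrier[OF S] by simp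
  qed (simp_all add: eq)
qed

section \<open>Conjugation and powers in a group\<close>

context group
begin

lemma inv_mult_cancel: "x \<in> carrier G \<Longrightarrow> y \<in> carrier G \<Longrightarrow> inv x \<otimes> (x \<otimes> y) = y"
  by (simp add: m_assoc[symmetric])

lemma mult_inv_cancel: "x \<in> carrier G \<Longrightarrow> y \<in> carrier G \<Longrightarrow> x \<otimes> (inv x \<otimes> y) = y"
  by (simp add: m_assoc[symmetric])

text \<open>
  Rewriting with these rules reduces words freely, in right-associated form.
\<close>

lemmas word_simps = m_assoc inv_mult_group inv_mult_cancel mult_inv_cancel

text \<open>
  Conjugation identities are kept in the form \<open>x \<otimes> p = p' \<otimes> x\<close>, which says that conjugation by
  \<open>x\<close> takes \<open>p\<close> to \<open>p'\<close>. This and the next lemmas express that conjugation is multiplicative in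
  the conjugated and in the conjugating element; a conjugate of a word is then found by following
  the shape of the word.
\<close>

lemma conj_mult:
  assumes "x \<otimes> p = p' \<otimes> x" "x \<otimes> q = q' \<otimes> x"
    and "x \<in> carrier G" "p \<in> carrier G" "q \<in> carrier G" "p' \<in> carrier G" "q' \<in> carrier G"
  shows "x \<otimes> (p \<otimes> q) = p' \<otimes> q' \<otimes> x"
proof -
  have "x \<otimes> (p \<otimes> q) = (x \<otimes> p) \<otimes> q"
    using assms(3-) by (simp add: m_assoc)
  also have "\<dots> = p' \<otimes> (x \<otimes> q)"
    unfolding assms(1) using assms(3-) by (simp add: m_assoc)
  also have "\<dots> = p' \<otimes> q' \<otimes> x"
    unfolding assms(2) using assms(3-) by (simp add: m_assoc)
  finally show ?thesis .
qed

lemma conj_inv: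
  assumes "x \<otimes> p = p' \<otimes> x" and "x \<in> carrier G" "p \<in> carrier G" "p' \<in> carrier G"
  shows "x \<otimes> inv p = inv p' \<otimes> x"
proof -
  have "inv p' \<otimes> (x \<otimes> p) \<otimes> inv p = inv p' \<otimes> (p' \<otimes> x) \<otimes> inv p"
    by (simp add: assms(1))
  then show ?thesis
    using assms(2-) by (simp add: word_simps)
qed

lemma inv_conj:
  assumes "x \<otimes> p = p' \<otimes> x" and "x \<in> carrier G" "p \<in> carrier G" "p' \<in> carrier G"
  shows "inv x \<otimes> p' = p \<otimes> inv x"
proof -
  have "inv x \<otimes> (x \<otimes> p) \<otimes> inv x = inv x \<otimes> (p' \<otimes> x) \<otimes> inv x"
    by (simp add: assms(1))
  then show ?thesis
    using assms(2-) by (simp add: word_simps)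
qed

lemma conj_comp:
  assumes "q \<otimes> w = w' \<otimes> q" "p \<otimes> w' = w'' \<otimes> p"
    and "p \<in> carrier G" "q \<in> carrier G" "w \<in> carrier G" "w' \<in> carrier G" "w'' \<in> carrier G"
  shows "p \<otimes> q \<otimes> w = w'' \<otimes> (p \<otimes> q)"
proof -
  have "p \<otimes> q \<otimes> w = p \<otimes> (q \<otimes> w)"
    using assms(3-) by (simp add: m_assoc)
  also have "\<dots> = (p \<otimes> w') \<otimes> q"
    unfolding assms(1) using assms(3-) by (simp add: m_assoc)
  also have "\<dots> = w'' \<otimes> (p \<otimes> q)"
    unfolding assms(2) using assms(3-) by (simp add: m_assoc)
  finally show ?thesis .
qed

lemma int_pow_2: "x \<in> carrier G \<Longrightarrow> x [^] (2 :: int) = x \<otimes> x"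
  using int_pow_mult[of x 1 1] by simp

lemma int_pow_even:
  assumes "x \<in> carrier G"
  shows "x [^] (2 * k :: int) = (x \<otimes> x) [^] k"
  using int_pow_pow[OF assms, of 2 k] assms by (simp add: int_pow_2)

lemma int_pow_odd:
  assumes "x \<in> carrier G"
  shows "x [^] (2 * k + 1 :: int) = (x \<otimes> x) [^] k \<otimes> x"
  using assms by (simp add: int_pow_mult int_pow_even)

lemma conj_int_pow:
  assumes eq: "x \<otimes> p = p' \<otimes> x" and cl: "x \<in> carrier G" "p \<in> carrier G" "p' \<in> carrier G"
  shows "x \<otimes> p [^] (k :: int) = p' [^] k \<otimes> x"
proof -
  have nat: "x \<otimes> p [^] (n :: nat) = p' [^] n \<otimes> x" for n
  proof (induction n)
    case (Suc n)
    show ?case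
      unfolding nat_pow_Suc by (intro conj_mult Suc eq) (simp_all add: cl)
  qed (simp add: cl)
  show ?thesis
  proof (cases k)
    case (nonneg n)
    then show ?thesis
      by (simp only: int_pow_int nat)
  next
    case (neg n)
    show ?thesis
      unfolding neg using conj_inv[OF nat[of "Suc n"]] cl by (simp only: int_pow_neg_int nat_pow_closed)
  qed
qed

lemma commute_int_pow:
  assumes "x \<otimes> p = p \<otimes> x" "x \<in> carrier G" "p \<in> carrier G"
  shows "x [^] (k :: int) \<otimes> p = p \<otimes> x [^] k"
  using conj_int_pow[of p x x k] assms by simp

lemma int_pow_conj:
  assumes "x \<in> carrier G" "p \<in> carrier G"
  shows "(x \<otimes> p \<otimes> inv x) [^] (k :: int) = x \<otimes> p [^] k \<otimes> inv x"
proof -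
  have "x \<otimes> p [^] k = (x \<otimes> p \<otimes> inv x) [^] k \<otimes> x"
    using assms by (intro conj_int_pow) (simp_all add: word_simps)
  then show ?thesis
    using assms by (simp add: word_simps)
qed

text \<open>
  The relation of \<open>\<int> \<rtimes> \<int>\<close>: the square of \<open>y\<close> commutes with \<open>x\<close>, so only the parity of the
  exponent of \<open>y\<close> matters.
\<close>

lemma inverting_int_pow:
  assumes eq: "y \<otimes> x = inv x \<otimes> y" and cl: "x \<in> carrier G" "y \<in> carrier G"
  shows "y [^] (n :: int) \<otimes> x [^] (m :: int) = x [^] (if even n then m else - m) \<otimes> y [^] n"
proof -
  have "y \<otimes> y \<otimes> x = x \<otimes> (y \<otimes> y)"
    by (rule conj_comp[OF eq]) (use conj_inv[OF eq] cl in simp_all)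
  then have yy: "(y \<otimes> y) [^] k \<otimes> x [^] m = x [^] m \<otimes> (y \<otimes> y) [^] k" for k :: int and m :: int
    using cl by (intro conj_int_pow commute_int_pow) simp_all
  show ?thesis
  proof (cases "even n")
    case True
    then obtain k where "n = 2 * k" by (elim evenE)
    then show ?thesis
      using yy cl by (simp add: int_pow_even)
  next
    case False
    then obtain k where n: "n = 2 * k + 1" by (elim oddE)
    have "y \<otimes> x [^] m = x [^] (- m) \<otimes> y"
      using conj_int_pow[OF eq, of m] cl by (simp add: int_pow_inv int_pow_neg)
    then have "(y \<otimes> y) [^] k \<otimes> y \<otimes> x [^] m = x [^] (- m) \<otimes> ((y \<otimes> y) [^] k \<otimes> y)"
      by (rule conj_comp[OF _ yy]) (simp_all add: cl)
    then show ?thesis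
      using cl by (simp add: n int_pow_odd)
  qed
qed

end

section \<open>Semi-direct products\<close>

lemma semidirect_simps [simp]:
  "carrier (semidirect N H \<theta>) = carrier N \<times> carrier H"
  "(w, g) \<otimes>\<^bsub>semidirect N H \<theta>\<^esub> (w', g') = (w \<otimes>\<^bsub>N\<^esub> \<theta> g w', g \<otimes>\<^bsub>H\<^esub> g')"
  "\<one>\<^bsub>semidirect N H \<theta>\<^esub> = (\<one>\<^bsub>N\<^esub>, \<one>\<^bsub>H\<^esub>)"
  by (simp_all add: semidirect_def)

locale group_action_by_homs = N: group N + H: group H
  for N :: "('a, 'm) monoid_scheme" and H :: "('b, 'n) monoid_scheme" and \<theta> :: "'b \<Rightarrow> 'a \<Rightarrow> 'a" +
  assumes act_hom: "g \<in> carrier H \<Longrightarrow> \<theta> g \<in> hom N N"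
    and act_mult: "g \<in> carrier H \<Longrightarrow> h \<in> carrier H \<Longrightarrow> w \<in> carrier N \<Longrightarrow>
      \<theta> (g \<otimes>\<^bsub>H\<^esub> h) w = \<theta> g (\<theta> h w)"
    and act_one: "w \<in> carrier N \<Longrightarrow> \<theta> \<one>\<^bsub>H\<^esub> w = w"
begin

lemma act_closed [simp]: "g \<in> carrier H \<Longrightarrow> w \<in> carrier N \<Longrightarrow> \<theta> g w \<in> carrier N"
  using act_hom hom_in_carrier by metis

lemma act_mult_right:
  "g \<in> carrier H \<Longrightarrow> w \<in> carrier N \<Longrightarrow> w' \<in> carrier N \<Longrightarrow>
    \<theta> g (w \<otimes>\<^bsub>N\<^esub> w') = \<theta> g w \<otimes>\<^bsub>N\<^esub> \<theta> g w'"
  using act_hom hom_mult by metis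

lemma act_one_right: "g \<in> carrier H \<Longrightarrow> \<theta> g \<one>\<^bsub>N\<^esub> = \<one>\<^bsub>N\<^esub>"
  using hom_one[OF act_hom] N.is_group by metis

lemma group_semidirect: "group (semidirect N H \<theta>)"
proof (rule groupI)
  fix p assume "p \<in> carrier (semidirect N H \<theta>)"
  then obtain w g where p: "p = (w, g)" "w \<in> carrier N" "g \<in> carrier H"
    by auto
  have "\<theta> (inv\<^bsub>H\<^esub> g) (inv\<^bsub>N\<^esub> w) \<otimes>\<^bsub>N\<^esub> \<theta> (inv\<^bsub>H\<^esub> g) w = \<one>\<^bsub>N\<^esub>"
    using p by (simp flip: act_mult_right add: act_one_right)
  then show "\<exists>q\<in>carrier (semidirect N H \<theta>). q \<otimes>\<^bsub>semidirect N H \<theta>\<^esub> p = \<one>\<^bsub>semidirect N H \<theta>\<^esub>"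
    using p by (intro bexI[of _ "(\<theta> (inv\<^bsub>H\<^esub> g) (inv\<^bsub>N\<^esub> w), inv\<^bsub>H\<^esub> g)"]) auto
qed (auto simp: N.m_assoc H.m_assoc act_mult act_mult_right act_one)

lemma semidirect_embeds:
  shows "(\<lambda>w. (w, \<one>\<^bsub>H\<^esub>)) \<in> hom N (semidirect N H \<theta>)"
    and "(\<lambda>g. (\<one>\<^bsub>N\<^esub>, g)) \<in> hom H (semidirect N H \<theta>)"
  by (auto simp: hom_def act_one act_one_right)

lemma generate_semidirect:
  assumes S: "generate N S = carrier N" "S \<subseteq> carrier N"
    and T: "generate H T = carrier H" "T \<subseteq> carrier H"
  shows "generate (semidirect N H \<theta>) ((\<lambda>w. (w, \<one>\<^bsub>H\<^esub>)) ` S \<union> (\<lambda>g. (\<one>\<^bsub>N\<^esub>, g)) ` T) =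
    carrier (semidirect N H \<theta>)"
    (is "generate ?SD (?S \<union> ?T) = _")
proof -
  interpret SD: group ?SD
    by (rule group_semidirect)
  interpret n: group_hom N ?SD "\<lambda>w. (w, \<one>\<^bsub>H\<^esub>)"
    using semidirect_embeds by unfold_locales
  interpret h: group_hom H ?SD "\<lambda>g. (\<one>\<^bsub>N\<^esub>, g)"
    using semidirect_embeds by unfold_locales
  have "(w, \<one>\<^bsub>H\<^esub>) \<in> generate ?SD (?S \<union> ?T)" if "w \<in> carrier N" for w
    using n.generate_img[OF S(2)] S(1) SD.mono_generate[of ?S "?S \<union> ?T"] that by blast
  moreover have "(\<one>\<^bsub>N\<^esub>, g) \<in> generate ?SD (?S \<union> ?T)" if "g \<in> carrier H" for g
    using h.generate_img[OF T(2)] T(1) SD.mono_generate[of ?T "?S \<union> ?T"] that by blast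
  ultimately have "(w, g) \<in> generate ?SD (?S \<union> ?T)" if "w \<in> carrier N" "g \<in> carrier H" for w g
    using generate.eng[of "(w, \<one>\<^bsub>H\<^esub>)" ?SD "?S \<union> ?T" "(\<one>\<^bsub>N\<^esub>, g)"] that
    by (simp add: act_one)
  moreover have "?S \<union> ?T \<subseteq> carrier ?SD"
    using S(2) T(2) by auto
  ultimately show ?thesis
    using SD.generate_incl[of "?S \<union> ?T"] by auto
qed

text \<open>
  A pair of homomorphisms extends to the semi-direct product if conjugation in the target
  realizes the action. It suffices to test this on generators of both factors: for a fixed
  acting element both sides are homomorphisms in \<open>w\<close>, and the acting elements that pass the test
  for all \<open>w\<close> are closed under products and inverses.
\<close>

lemma semidirect_hom:
  assumes G: "group G" and \<phi>: "\<phi> \<in> hom N G" and \<rho>: "\<rho> \<in> hom H G"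
    and S: "generate N S = carrier N" "S \<subseteq> carrier N"
    and T: "generate H T = carrier H" "T \<subseteq> carrier H"
    and compat: "\<And>g w. g \<in> T \<Longrightarrow> w \<in> S \<Longrightarrow> \<rho> g \<otimes>\<^bsub>G\<^esub> \<phi> w = \<phi> (\<theta> g w) \<otimes>\<^bsub>G\<^esub> \<rho> g"
  shows "(\<lambda>(w, g). \<phi> w \<otimes>\<^bsub>G\<^esub> \<rho> g) \<in> hom (semidirect N H \<theta>) G"
proof -
  interpret G: group G by fact
  interpret \<phi>: group_hom N G \<phi> using \<phi> by unfold_locales
  interpret \<rho>: group_hom H G \<rho> using \<rho> by unfold_locales
  have T_compat: "\<rho> g \<otimes>\<^bsub>G\<^esub> \<phi> w = \<phi> (\<theta> g w) \<otimes>\<^bsub>G\<^esub> \<rho> g"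
    if g: "g \<in> T" and "w \<in> generate N S" for g w
  proof -
    have gH: "g \<in> carrier H"
      using g T by blast
    interpret \<theta>: group_hom N N "\<theta> g"
      using act_hom[OF gH] by unfold_locales
    show ?thesis
      using that(2)
    proof induction
      case (inv w)
      then have "w \<in> carrier N"
        using S by blast
      then show ?case
        using G.conj_inv[OF compat[OF g inv]] gH by simp
    next
      case (eng w w')
      then have "w \<in> carrier N" "w' \<in> carrier N"
        using S by simp_all
      then show ?case
        using G.conj_mult[OF eng.IH] gH by simp
    qed (use g gH compat in simp_all)
  qed
  have compat': "\<rho> g \<otimes>\<^bsub>G\<^esub> \<phi> w = \<phi> (\<theta> g w) \<otimes>\<^bsub>G\<^esub> \<rho> g"
    if "g \<in> generate H T" and "w \<in> carrier N" for g w
    using that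
  proof (induction arbitrary: w)
    case (inv g)
    then have g: "g \<in> carrier H"
      using T by blast
    have "\<theta> g (\<theta> (inv\<^bsub>H\<^esub> g) w) = w"
      using g inv.prems act_mult[of g "inv\<^bsub>H\<^esub> g" w] by (simp add: act_one)
    then have "\<rho> g \<otimes>\<^bsub>G\<^esub> \<phi> (\<theta> (inv\<^bsub>H\<^esub> g) w) = \<phi> w \<otimes>\<^bsub>G\<^esub> \<rho> g"
      using T_compat[OF inv.hyps, of "\<theta> (inv\<^bsub>H\<^esub> g) w"] S g inv.prems by simp
    then show ?case
      using G.inv_conj g inv.prems by simp
  next
    case (eng g h)
    then have gh: "g \<in> carrier H" "h \<in> carrier H"
      using T by simp_all
    then have "\<rho> g \<otimes>\<^bsub>G\<^esub> \<rho> h \<otimes>\<^bsub>G\<^esub> \<phi> w = \<phi> (\<theta> g (\<theta> h w)) \<otimes>\<^bsub>G\<^esub> (\<rho> g \<otimes>\<^bsub>G\<^esub> \<rho> h)"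
      using eng.prems by (intro G.conj_comp[OF eng.IH(2) eng.IH(1)]) simp_all
    then show ?case
      using gh eng.prems by (simp add: act_mult)
  qed (use S T_compat in \<open>auto simp: act_one\<close>)
  show ?thesis
  proof (rule homI)
    fix p q assume "p \<in> carrier (semidirect N H \<theta>)" "q \<in> carrier (semidirect N H \<theta>)"
    then obtain w g w' g' where pq: "p = (w, g)" "q = (w', g')"
      and cl: "w \<in> carrier N" "g \<in> carrier H" "w' \<in> carrier N" "g' \<in> carrier H"
      by auto
    have "\<phi> (w \<otimes>\<^bsub>N\<^esub> \<theta> g w') \<otimes>\<^bsub>G\<^esub> \<rho> (g \<otimes>\<^bsub>H\<^esub> g') = \<phi> w \<otimes>\<^bsub>G\<^esub> (\<phi> (\<theta> g w') \<otimes>\<^bsub>G\<^esub> \<rho> g) \<otimes>\<^bsub>G\<^esub> \<rho> g'"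
      using cl by (simp add: G.m_assoc)
    also have "\<dots> = \<phi> w \<otimes>\<^bsub>G\<^esub> \<rho> g \<otimes>\<^bsub>G\<^esub> (\<phi> w' \<otimes>\<^bsub>G\<^esub> \<rho> g')"
      using cl T compat'[of g w', symmetric] by (simp add: G.m_assoc)
    finally show "(case p \<otimes>\<^bsub>semidirect N H \<theta>\<^esub> q of (w, g) \<Rightarrow> \<phi> w \<otimes>\<^bsub>G\<^esub> \<rho> g) =
        (case p of (w, g) \<Rightarrow> \<phi> w \<otimes>\<^bsub>G\<^esub> \<rho> g) \<otimes>\<^bsub>G\<^esub> (case q of (w, g) \<Rightarrow> \<phi> w \<otimes>\<^bsub>G\<^esub> \<rho> g)"
      by (simp add: pq)
  qed auto
qed

end

section \<open>Relations in the braid group of the Klein bottle\<close>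

text \<open>
  The computations use nothing but the defining relations. Conjugating a relation by \<open>\<sigma>\<close> gives a
  second one, because \<open>\<sigma>\<^sup>2 = B\<close> returns \<open>b\<^sub>i\<close> to a conjugate of \<open>a\<^sub>i\<close>; this is where the pairs of
  relations between \<open>a\<^sub>i\<close>, \<open>b\<^sub>i\<close> and \<open>B\<close> come from.
\<close>

locale klein_bottle_braids = group G for G (structure) +
  fixes a1 a2 s
  assumes closed [simp]: "a1 \<in> carrier G" "a2 \<in> carrier G" "s \<in> carrier G"
    and rel1: "inv s \<otimes> a1 \<otimes> inv s \<otimes> a1 = a1 \<otimes> inv s \<otimes> a1 \<otimes> s"
    and rel2: "inv s \<otimes> a2 \<otimes> inv s \<otimes> a2 = a2 \<otimes> inv s \<otimes> a2 \<otimes> s"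
    and rel12: "inv s \<otimes> a1 \<otimes> s \<otimes> a2 = a2 \<otimes> inv s \<otimes> a1 \<otimes> s"
    and rel_surface: "a1 \<otimes> a1 \<otimes> a2 \<otimes> a2 = s \<otimes> s"
begin

definition "b1 = s \<otimes> a1 \<otimes> inv s"
definition "b2 = s \<otimes> a2 \<otimes> inv s"
definition "B = s \<otimes> s"
definition "u = b1 \<otimes> b2"
definition "v = inv b2"
definition "x = b1 \<otimes> a1"
definition "y = b2 \<otimes> a2"
definition "X = b1 \<otimes> a1 \<otimes> b2 \<otimes> a2"
definition "Y = inv a2 \<otimes> inv b2"

lemma more_closed [simp]:
  "b1 \<in> carrier G" "b2 \<in> carrier G" "B \<in> carrier G" "u \<in> carrier G" "v \<in> carrier G"
  "x \<in> carrier G" "y \<in> carrier G" "X \<in> carrier G" "Y \<in> carrier G"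
  by (simp_all add: b1_def b2_def B_def u_def v_def x_def y_def X_def Y_def)

lemma X_eq: "X = x \<otimes> y" and Y_eq: "Y = inv y"
  by (simp_all add: X_def Y_def x_def y_def word_simps)

text \<open>
  The relation \<open>\<sigma>\<^sup>-\<^sup>1a\<^sub>1\<sigma>\<^sup>-\<^sup>1a\<^sub>1 = a\<^sub>1\<sigma>\<^sup>-\<^sup>1a\<^sub>1\<sigma>\<close> conjugated by \<open>\<sigma>\<close>. Taken as it stands, and combined
  with this form, it says that \<open>x\<close> inverts \<open>B\<close> (lemma \<open>x_B\<close>).
\<close>

lemma x_swap: "x = a1 \<otimes> inv B \<otimes> b1"
proof -
  have "x = s \<otimes> (a1 \<otimes> inv s \<otimes> a1 \<otimes> s) \<otimes> inv s"
    by (simp add: x_def b1_def word_simps)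
  also have "\<dots> = a1 \<otimes> inv B \<otimes> b1"
    unfolding rel1[symmetric] by (simp add: b1_def B_def word_simps)
  finally show ?thesis .
qed

lemma y_swap: "y = a2 \<otimes> inv B \<otimes> b2"
proof -
  have "y = s \<otimes> (a2 \<otimes> inv s \<otimes> a2 \<otimes> s) \<otimes> inv s"
    by (simp add: y_def b2_def word_simps)
  also have "\<dots> = a2 \<otimes> inv B \<otimes> b2"
    unfolding rel2[symmetric] by (simp add: b2_def B_def word_simps)
  finally show ?thesis .
qed

lemma x_B: "x \<otimes> B = inv B \<otimes> x"
proof -
  have "x \<otimes> B = a1 \<otimes> inv s \<otimes> a1 \<otimes> s"
    unfolding x_swap by (simp add: b1_def B_def word_simps)
  also have "\<dots> = inv B \<otimes> x"
    unfolding rel1[symmetric] by (simp add: x_def b1_def B_def word_simps)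
  finally show ?thesis .
qed

lemma y_B: "y \<otimes> B = inv B \<otimes> y"
proof -
  have "y \<otimes> B = a2 \<otimes> inv s \<otimes> a2 \<otimes> s"
    unfolding y_swap by (simp add: b2_def B_def word_simps)
  also have "\<dots> = inv B \<otimes> y"
    unfolding rel2[symmetric] by (simp add: y_def b2_def B_def word_simps)
  finally show ?thesis .
qed

lemma x_inv_B: "x \<otimes> inv B = B \<otimes> x"
  using conj_inv[OF x_B] by simp

lemma y_inv_B: "y \<otimes> inv B = B \<otimes> y"
  using conj_inv[OF y_B] by simp

text \<open>
  The relation between \<open>a\<^sub>1\<close> and \<open>a\<^sub>2\<close>, conjugated by \<open>\<sigma>\<close>; unconjugated, it says that \<open>a\<^sub>2\<close> commutes
  with \<open>B\<^sup>-\<^sup>1b\<^sub>1B\<close>, which equals \<open>\<sigma>\<^sup>-\<^sup>1a\<^sub>1\<sigma>\<close>.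
\<close>

lemma a1_b2: "a1 \<otimes> b2 = b2 \<otimes> a1"
proof -
  have "a1 \<otimes> b2 = s \<otimes> (inv s \<otimes> a1 \<otimes> s \<otimes> a2) \<otimes> inv s"
    by (simp add: b2_def word_simps)
  also have "\<dots> = b2 \<otimes> a1"
    unfolding rel12 by (simp add: b2_def word_simps)
  finally show ?thesis .
qed

lemma a2_c: "a2 \<otimes> (inv B \<otimes> b1 \<otimes> B) = (inv B \<otimes> b1 \<otimes> B) \<otimes> a2"
  using rel12 by (simp add: b1_def B_def word_simps)

lemma B_eq_a: "a1 \<otimes> a1 \<otimes> a2 \<otimes> a2 = B"
  using rel_surface by (simp add: B_def)

lemma B_eq_b: "B = b1 \<otimes> b1 \<otimes> b2 \<otimes> b2"
proof -
  have "b1 \<otimes> b1 \<otimes> b2 \<otimes> b2 = s \<otimes> (a1 \<otimes> a1 \<otimes> a2 \<otimes> a2) \<otimes> inv s"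
    by (simp add: b1_def b2_def word_simps)
  then show ?thesis
    unfolding rel_surface by (simp add: B_def word_simps)
qed

lemma B_eq_uv: "B = u \<otimes> v \<otimes> u \<otimes> inv v"
  by (simp add: B_eq_b u_def v_def word_simps)

text \<open>
  As \<open>x\<close> inverts \<open>B\<close>, it equals \<open>B\<^sup>-\<^sup>1xB\<^sup>-\<^sup>1\<close>; in \<open>B\<^sup>-\<^sup>1b\<^sub>1a\<^sub>1B\<^sup>-\<^sup>1b\<^sub>1\<close> the last three factors form \<open>x\<close> again,
  by \<open>x_swap\<close>.
\<close>

lemma x_b1: "x \<otimes> b1 = inv B \<otimes> b1 \<otimes> x"
proof -
  have "x \<otimes> b1 = inv B \<otimes> x \<otimes> inv B \<otimes> b1"
    using x_inv_B by (simp add: word_simps)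
  also have "\<dots> = inv B \<otimes> b1 \<otimes> (a1 \<otimes> inv B \<otimes> b1)"
    by (simp add: x_def word_simps)
  finally show ?thesis
    unfolding x_swap[symmetric] .
qed

lemma y_b2: "y \<otimes> b2 = inv B \<otimes> b2 \<otimes> y"
proof -
  have "y \<otimes> b2 = inv B \<otimes> y \<otimes> inv B \<otimes> b2"
    using y_inv_B by (simp add: word_simps)
  also have "\<dots> = inv B \<otimes> b2 \<otimes> (a2 \<otimes> inv B \<otimes> b2)"
    by (simp add: y_def word_simps)
  finally show ?thesis
    unfolding y_swap[symmetric] .
qed

lemma x_b2: "x \<otimes> b2 = b1 \<otimes> b2 \<otimes> inv b1 \<otimes> x"
  using a1_b2 by (simp add: x_def word_simps)

lemma y_c: "y \<otimes> (inv B \<otimes> b1 \<otimes> B) = b2 \<otimes> (inv B \<otimes> b1 \<otimes> B) \<otimes> inv b2 \<otimes> y"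
proof -
  have "y \<otimes> (inv B \<otimes> b1 \<otimes> B) = b2 \<otimes> (a2 \<otimes> (inv B \<otimes> b1 \<otimes> B))"
    by (simp add: y_def word_simps)
  then show ?thesis
    unfolding a2_c by (simp add: y_def word_simps)
qed

lemma x_u: "x \<otimes> u = inv u \<otimes> x"
proof -
  have "x \<otimes> u = (inv B \<otimes> b1) \<otimes> (b1 \<otimes> b2 \<otimes> inv b1) \<otimes> x"
    unfolding u_def by (rule conj_mult[OF x_b1 x_b2]) simp_all
  also have "(inv B \<otimes> b1) \<otimes> (b1 \<otimes> b2 \<otimes> inv b1) = inv u"
    by (simp add: u_def B_eq_b word_simps)
  finally show ?thesis .
qed

lemma y_u: "y \<otimes> u = inv B \<otimes> inv u \<otimes> B \<otimes> y"
proof -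
  have cancel: "b2 \<otimes> inv B \<otimes> b1 = inv u"
    by (simp add: u_def B_eq_b word_simps)
  (* Only for the conjugate B^-1 b1 B of b1 is the effect of y known, whence this splitting of u. *)
  have "u = B \<otimes> (inv B \<otimes> b1 \<otimes> B) \<otimes> (inv B \<otimes> b2)"
    by (simp add: u_def word_simps)
  then have "y \<otimes> u = y \<otimes> (B \<otimes> (inv B \<otimes> b1 \<otimes> B) \<otimes> (inv B \<otimes> b2))"
    by (rule arg_cong)
  also have "\<dots> = inv B \<otimes> (b2 \<otimes> (inv B \<otimes> b1 \<otimes> B) \<otimes> inv b2) \<otimes> (B \<otimes> (inv B \<otimes> b2)) \<otimes> y"
    by (intro conj_mult y_B y_c y_inv_B y_b2) simp_all
  also have "\<dots> = inv B \<otimes> (b2 \<otimes> inv B \<otimes> b1) \<otimes> B \<otimes> y"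
    by (simp add: word_simps)
  finally show ?thesis
    unfolding cancel .
qed

lemma y_v: "y \<otimes> v = v \<otimes> B \<otimes> y"
  using conj_inv[OF y_b2] by (simp add: v_def word_simps)

lemma x_v: "x \<otimes> v = b1 \<otimes> v \<otimes> inv b1 \<otimes> x"
  using conj_inv[OF x_b2] by (simp add: v_def word_simps)

text \<open>
  By \<open>x_b1\<close> and \<open>y_b2\<close>, \<open>x\<^sup>2 = B\<^sup>-\<^sup>1b\<^sub>1\<^sup>2a\<^sub>1\<^sup>2\<close> and \<open>y\<^sup>2 = B\<^sup>-\<^sup>1b\<^sub>2\<^sup>2a\<^sub>2\<^sup>2\<close>. In the product \<open>x\<^sup>2\<close> commutes with
  \<open>B\<close>, and \<open>a\<^sub>1\<^sup>2\<close> with \<open>b\<^sub>2\<^sup>2\<close>, so that the two surface relations cancel both factors \<open>B\<^sup>-\<^sup>1\<close>.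
\<close>

lemma xx_yy: "x \<otimes> x \<otimes> (y \<otimes> y) = \<one>"
proof -
  have xx: "x \<otimes> x = inv B \<otimes> b1 \<otimes> b1 \<otimes> a1 \<otimes> a1"
  proof -
    have "x \<otimes> x = x \<otimes> b1 \<otimes> a1"
      by (simp add: x_def m_assoc)
    then show ?thesis
      unfolding x_b1 by (simp add: x_def m_assoc)
  qed
  have yy: "y \<otimes> y = inv B \<otimes> b2 \<otimes> b2 \<otimes> a2 \<otimes> a2"
  proof -
    have "y \<otimes> y = y \<otimes> b2 \<otimes> a2"
      by (simp add: y_def m_assoc)
    then show ?thesis
      unfolding y_b2 by (simp add: y_def m_assoc)
  qed
  have "x \<otimes> x \<otimes> inv B = inv B \<otimes> (x \<otimes> x)"
    by (intro conj_comp[OF x_inv_B x_B]) simp_all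
  then have "x \<otimes> x \<otimes> (y \<otimes> y) = inv B \<otimes> (x \<otimes> x) \<otimes> (b2 \<otimes> b2 \<otimes> a2 \<otimes> a2)"
    unfolding yy by (simp add: m_assoc[symmetric])
  also have "\<dots> = inv B \<otimes> inv B \<otimes> b1 \<otimes> b1 \<otimes> (a1 \<otimes> a1 \<otimes> (b2 \<otimes> b2)) \<otimes> a2 \<otimes> a2"
    unfolding xx by (simp add: word_simps)
  also have "a1 \<otimes> a1 \<otimes> (b2 \<otimes> b2) = b2 \<otimes> b2 \<otimes> (a1 \<otimes> a1)"
    by (intro conj_mult conj_comp[OF a1_b2 a1_b2]) simp_all
  also have "inv B \<otimes> inv B \<otimes> b1 \<otimes> b1 \<otimes> (b2 \<otimes> b2 \<otimes> (a1 \<otimes> a1)) \<otimes> a2 \<otimes> a2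
      = inv B \<otimes> inv B \<otimes> (b1 \<otimes> b1 \<otimes> b2 \<otimes> b2) \<otimes> (a1 \<otimes> a1 \<otimes> a2 \<otimes> a2)"
    by (simp add: word_simps)
  finally show ?thesis
    unfolding B_eq_a B_eq_b[symmetric] by (simp add: word_simps)
qed

lemma Y_X: "Y \<otimes> X = inv X \<otimes> Y"
proof -
  have "inv x \<otimes> (x \<otimes> x \<otimes> (y \<otimes> y)) \<otimes> inv y = inv x \<otimes> inv y"
    unfolding xx_yy by simp
  then have "x \<otimes> y = inv x \<otimes> inv y"
    by (simp add: word_simps)
  moreover have "inv (x \<otimes> y) = inv y \<otimes> inv x"
    by (simp add: inv_mult_group)
  ultimately show ?thesis
    unfolding X_eq Y_eq by (simp only: m_assoc inv_closed more_closed)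
qed

lemma Y_B: "Y \<otimes> B = inv B \<otimes> Y"
  unfolding Y_eq by (rule inv_conj) (simp_all add: y_inv_B)

lemma Y_u: "Y \<otimes> u = inv B \<otimes> inv u \<otimes> B \<otimes> Y"
proof -
  have "y \<otimes> (inv B \<otimes> inv u \<otimes> B) = B \<otimes> inv (inv B \<otimes> inv u \<otimes> B) \<otimes> inv B \<otimes> y"
    by (intro conj_mult conj_inv y_inv_B y_B y_u) simp_all
  then have "y \<otimes> (inv B \<otimes> inv u \<otimes> B) = u \<otimes> y"
    by (simp add: word_simps)
  then show ?thesis
    unfolding Y_eq by (rule inv_conj) simp_all
qed

lemma Y_v: "Y \<otimes> v = v \<otimes> B \<otimes> Y"
proof -
  have "y \<otimes> (v \<otimes> B) = v \<otimes> B \<otimes> inv B \<otimes> y"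
    by (intro conj_mult y_v y_B) simp_all
  then have "y \<otimes> (v \<otimes> B) = v \<otimes> y"
    by (simp add: word_simps)
  then show ?thesis
    unfolding Y_eq by (rule inv_conj) simp_all
qed

lemma X_B: "X \<otimes> B = B \<otimes> X"
  unfolding X_eq by (intro conj_comp[OF y_B x_inv_B]) simp_all

lemma X_u: "X \<otimes> u = B \<otimes> u \<otimes> inv B \<otimes> X"
proof -
  have "x \<otimes> (inv B \<otimes> inv u \<otimes> B) = B \<otimes> inv (inv u) \<otimes> inv B \<otimes> x"
    by (intro conj_mult conj_inv x_inv_B x_B x_u) simp_all
  then show ?thesis
    unfolding X_eq by (intro conj_comp[OF y_u]) simp_all
qed

lemma X_v: "X \<otimes> v = B \<otimes> v \<otimes> inv u \<otimes> inv u \<otimes> inv B \<otimes> X"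
proof -
  have "x \<otimes> (v \<otimes> B) = b1 \<otimes> v \<otimes> inv b1 \<otimes> inv B \<otimes> x"
    by (intro conj_mult x_v x_B) simp_all
  moreover have "b1 \<otimes> v \<otimes> inv b1 \<otimes> inv B = B \<otimes> v \<otimes> inv u \<otimes> inv u \<otimes> inv B"
    by (simp add: B_eq_b u_def v_def word_simps)
  ultimately show ?thesis
    unfolding X_eq by (intro conj_comp[OF y_v]) simp_all
qed

text \<open>
  Conjugation by \<open>\<sigma>\<close> turns \<open>b\<^sub>1a\<^sub>1\<close> into \<open>Ba\<^sub>1B\<^sup>-\<^sup>1b\<^sub>1\<close>, which is \<open>Bx\<close> by \<open>x_swap\<close>.
\<close>

lemma s_x: "s \<otimes> x = B \<otimes> x \<otimes> s"
proof -
  have "s \<otimes> x = B \<otimes> (a1 \<otimes> inv B \<otimes> b1) \<otimes> s"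
    by (simp add: x_def b1_def B_def word_simps)
  then show ?thesis
    unfolding x_swap[symmetric] .
qed

lemma s_y: "s \<otimes> y = B \<otimes> y \<otimes> s"
proof -
  have "s \<otimes> y = B \<otimes> (a2 \<otimes> inv B \<otimes> b2) \<otimes> s"
    by (simp add: y_def b2_def B_def word_simps)
  then show ?thesis
    unfolding y_swap[symmetric] .
qed

lemma s_B: "s \<otimes> B = B \<otimes> s"
  by (simp add: B_def m_assoc)

lemma s_X: "s \<otimes> X = X \<otimes> s"
proof -
  have "s \<otimes> X = B \<otimes> x \<otimes> (B \<otimes> y) \<otimes> s"
    unfolding X_eq by (intro conj_mult s_x s_y) simp_all
  moreover have "B \<otimes> x \<otimes> (B \<otimes> y) = X"
    unfolding X_eq x_inv_B[symmetric] by (simp add: word_simps)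
  ultimately show ?thesis
    by simp
qed

lemma s_Y: "s \<otimes> Y = B \<otimes> Y \<otimes> s"
proof -
  have "s \<otimes> Y = inv (B \<otimes> y) \<otimes> s"
    unfolding Y_eq by (intro conj_inv s_y) simp_all
  also have "inv (B \<otimes> y) = B \<otimes> Y"
    using conj_inv[OF Y_B] by (simp add: inv_mult_group Y_eq)
  finally show ?thesis .
qed

text \<open>
  Conjugation by \<open>\<sigma>\<close> turns \<open>b\<^sub>1b\<^sub>2\<close> into \<open>Ba\<^sub>1a\<^sub>2B\<^sup>-\<^sup>1\<close>. Since \<open>a\<^sub>1\<close> and \<open>b\<^sub>2\<close> commute, \<open>X = u a\<^sub>1a\<^sub>2\<close>, and
  \<open>X\<close> commutes with \<open>B\<close>.
\<close>

lemma s_u: "s \<otimes> u = B \<otimes> inv u \<otimes> inv B \<otimes> X \<otimes> s"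
proof -
  have X: "X = u \<otimes> (a1 \<otimes> a2)"
  proof -
    have "X = b1 \<otimes> (a1 \<otimes> b2) \<otimes> a2"
      by (simp add: X_def m_assoc)
    then show ?thesis
      unfolding a1_b2 by (simp add: u_def m_assoc)
  qed
  have "s \<otimes> u = B \<otimes> (a1 \<otimes> a2) \<otimes> inv B \<otimes> s"
    by (simp add: u_def b1_def b2_def B_def word_simps)
  also have "a1 \<otimes> a2 = inv u \<otimes> X"
    by (simp add: X word_simps)
  also have "B \<otimes> (inv u \<otimes> X) \<otimes> inv B = B \<otimes> inv u \<otimes> inv B \<otimes> X"
    using conj_inv[OF X_B] by (simp add: m_assoc)
  finally show ?thesis .
qed

lemma s_v: "s \<otimes> v = inv v \<otimes> B \<otimes> Y \<otimes> s"
proof -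
  have "s \<otimes> b2 = B \<otimes> (v \<otimes> y) \<otimes> inv B \<otimes> s"
    by (simp add: v_def y_def b2_def B_def word_simps)
  also have "B \<otimes> (v \<otimes> y) \<otimes> inv B = B \<otimes> v \<otimes> B \<otimes> y"
    using y_inv_B by (simp add: m_assoc)
  finally have "s \<otimes> v = inv (B \<otimes> v \<otimes> B \<otimes> y) \<otimes> s"
    unfolding v_def by (intro conj_inv) simp_all
  also have "inv (B \<otimes> v \<otimes> B \<otimes> y) = Y \<otimes> (inv B \<otimes> inv v \<otimes> inv B)"
    by (simp add: Y_eq word_simps)
  also have "\<dots> = inv (inv B) \<otimes> inv (v \<otimes> B) \<otimes> inv (inv B) \<otimes> Y"
    by (intro conj_mult conj_inv Y_B Y_v) simp_all
  also have "\<dots> = inv v \<otimes> B \<otimes> Y"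
    by (simp add: word_simps)
  finally show ?thesis .
qed

text \<open>
  In \<open>\<sigma>u\<sigma>\<^sup>-\<^sup>1 = (Bu\<^sup>-\<^sup>1)(B\<^sup>-\<^sup>1X)\<close> the second factor commutes with \<open>u\<close> and \<open>B\<close>: conjugation by \<open>X\<close>
  acts on \<open>u\<close> like conjugation by \<open>B\<close>.
\<close>

lemma s_u_pow: "s \<otimes> u [^] (r :: int) = (B \<otimes> inv u) [^] r \<otimes> B [^] (- r) \<otimes> X [^] r \<otimes> s"
proof -
  have BX_u: "inv B \<otimes> X \<otimes> u = u \<otimes> (inv B \<otimes> X)"
  proof -
    have "inv B \<otimes> X \<otimes> u = inv B \<otimes> (B \<otimes> u \<otimes> inv B \<otimes> X)"
      by (simp add: m_assoc X_u)
    then show ?thesis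
      by (simp add: word_simps)
  qed
  have BX_B: "inv B \<otimes> X \<otimes> B = B \<otimes> (inv B \<otimes> X)"
    by (simp add: m_assoc X_B mult_inv_cancel inv_mult_cancel)
  have "B \<otimes> inv u \<otimes> (inv B \<otimes> X) = inv B \<otimes> X \<otimes> (B \<otimes> inv u)"
    by (rule conj_mult[OF BX_B conj_inv[OF BX_u], symmetric]) simp_all
  then have "(B \<otimes> inv u \<otimes> (inv B \<otimes> X)) [^] r = (B \<otimes> inv u) [^] r \<otimes> (inv B \<otimes> X) [^] r"
    by (rule int_pow_mult_distrib) simp_all
  also have "(inv B \<otimes> X) [^] r = inv B [^] r \<otimes> X [^] r"
    using inv_conj[OF X_B[symmetric]] by (intro int_pow_mult_distrib) simp_all
  finally have "(B \<otimes> inv u \<otimes> inv B \<otimes> X) [^] r = (B \<otimes> inv u) [^] r \<otimes> B [^] (- r) \<otimes> X [^] r"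
    by (simp add: m_assoc int_pow_inv int_pow_neg)
  moreover have "s \<otimes> u [^] r = (B \<otimes> inv u \<otimes> inv B \<otimes> X) [^] r \<otimes> s"
    by (rule conj_int_pow[OF s_u]) simp_all
  ultimately show ?thesis
    by simp
qed

lemma s_Y_pow: "s \<otimes> Y [^] (n :: int) = B [^] delta n \<otimes> Y [^] n \<otimes> s"
proof -
  have "s \<otimes> Y [^] n = (B \<otimes> Y) [^] n \<otimes> s"
    by (rule conj_int_pow[OF s_Y]) simp_all
  moreover have "(B \<otimes> Y) \<otimes> (B \<otimes> Y) = Y \<otimes> Y"
  proof -
    have "(B \<otimes> Y) \<otimes> (B \<otimes> Y) = B \<otimes> (Y \<otimes> B) \<otimes> Y"
      by (simp add: m_assoc)
    then show ?thesis
      unfolding Y_B by (simp add: word_simps)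
  qed
  moreover have "(Y \<otimes> Y) [^] k \<otimes> B = B \<otimes> (Y \<otimes> Y) [^] k" for k :: int
  proof (rule commute_int_pow)
    show "Y \<otimes> Y \<otimes> B = B \<otimes> (Y \<otimes> Y)"
      by (rule conj_comp[OF Y_B]) (use conj_inv[OF Y_B] in simp_all)
  qed simp_all
  ultimately show ?thesis
    by (cases "even n") (auto elim!: evenE oddE simp: delta_def int_pow_even int_pow_odd m_assoc[symmetric])
qed

text \<open>
  The square of \<open>z = \<sigma>v\<sigma>\<^sup>-\<^sup>1\<close> is \<open>(uv)\<^sup>-\<^sup>2Y\<^sup>2\<close>, and \<open>Y\<^sup>2\<close> commutes with \<open>u\<close> and \<open>v\<close>. An odd power has
  one more factor \<open>z = (uv)\<^sup>-\<^sup>1(uB)Y\<close>.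
\<close>

lemma s_v_pow: "s \<otimes> v [^] (n :: int) =
    (u \<otimes> v) [^] (- n) \<otimes> (u \<otimes> B) [^] delta n \<otimes> Y [^] n \<otimes> s"
proof -
  define z where "z = inv v \<otimes> B \<otimes> Y"
  define p where "p = inv (u \<otimes> v)"
  have [simp]: "z \<in> carrier G" "p \<in> carrier G"
    by (simp_all add: z_def p_def)
  have pow: "s \<otimes> v [^] n = z [^] n \<otimes> s"
    unfolding z_def by (rule conj_int_pow[OF s_v]) simp_all
  have neg_pow: "(u \<otimes> v) [^] (- k) = p [^] k" for k :: int
    by (simp add: p_def int_pow_inv int_pow_neg)
  have YY_u: "Y \<otimes> Y \<otimes> u = u \<otimes> (Y \<otimes> Y)"
  proof (rule conj_comp[OF Y_u])
    have "Y \<otimes> (inv B \<otimes> inv u \<otimes> B) = inv (inv B) \<otimes> inv (inv B \<otimes> inv u \<otimes> B) \<otimes> inv B \<otimes> Y"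
      by (intro conj_mult conj_inv Y_u Y_B) simp_all
    then show "Y \<otimes> (inv B \<otimes> inv u \<otimes> B) = u \<otimes> Y"
      by (simp add: word_simps)
  qed simp_all
  have Y_vB: "Y \<otimes> (v \<otimes> B) = v \<otimes> Y"
  proof -
    have "Y \<otimes> (v \<otimes> B) = v \<otimes> B \<otimes> inv B \<otimes> Y"
      by (intro conj_mult Y_v Y_B) simp_all
    then show ?thesis
      by (simp add: word_simps)
  qed
  have YY_v: "Y \<otimes> Y \<otimes> v = v \<otimes> (Y \<otimes> Y)"
    by (rule conj_comp[OF Y_v Y_vB]) simp_all
  have "Y \<otimes> Y \<otimes> (u \<otimes> v) = u \<otimes> v \<otimes> (Y \<otimes> Y)"
    by (intro conj_mult YY_u YY_v) simp_all
  then have YY_p: "Y \<otimes> Y \<otimes> p = p \<otimes> (Y \<otimes> Y)"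
    unfolding p_def by (rule conj_inv) simp_all
  have zz: "z \<otimes> z = p \<otimes> p \<otimes> (Y \<otimes> Y)"
  proof -
    have "z \<otimes> z = inv v \<otimes> B \<otimes> (Y \<otimes> (inv v \<otimes> B)) \<otimes> Y"
      by (simp add: z_def m_assoc)
    also have "Y \<otimes> (inv v \<otimes> B) = inv (v \<otimes> B) \<otimes> inv B \<otimes> Y"
      by (intro conj_mult conj_inv Y_v Y_B) simp_all
    finally have "z \<otimes> z = inv v \<otimes> inv v \<otimes> inv B \<otimes> (Y \<otimes> Y)"
      by (simp add: word_simps)
    moreover have "inv v \<otimes> inv v \<otimes> inv B = p \<otimes> p"
      by (simp add: p_def B_eq_uv word_simps)
    ultimately show ?thesis
      by simp
  qed
  have even_pow: "(z \<otimes> z) [^] k = (p \<otimes> p) [^] k \<otimes> (Y \<otimes> Y) [^] k" for k :: int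
    unfolding zz
    by (rule int_pow_mult_distrib) (use conj_mult[OF YY_p YY_p] in simp_all)
  show ?thesis
  proof (cases "even n")
    case True
    then obtain k where "n = 2 * k" by (elim evenE)
    then show ?thesis
      unfolding pow neg_pow by (simp add: int_pow_even even_pow delta_def)
  next
    case False
    then obtain k where n: "n = 2 * k + 1" by (elim oddE)
    have YY_pow: "(Y \<otimes> Y) [^] k \<otimes> w = w \<otimes> (Y \<otimes> Y) [^] k" if "w \<in> {u, v}" for w
      using that YY_u YY_v by (intro commute_int_pow) auto
    have "(Y \<otimes> Y) [^] k \<otimes> (inv v \<otimes> B) = inv v \<otimes> B \<otimes> (Y \<otimes> Y) [^] k"
      unfolding B_eq_uv by (intro conj_mult conj_inv YY_pow) simp_all
    then have YY_z: "(Y \<otimes> Y) [^] k \<otimes> z = inv v \<otimes> B \<otimes> (Y \<otimes> Y) [^] k \<otimes> Y"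
      by (simp add: z_def m_assoc[symmetric])
    have "inv v \<otimes> B = p \<otimes> (u \<otimes> B)"
      by (simp add: p_def word_simps)
    with YY_z show ?thesis
      unfolding pow neg_pow by (simp add: n int_pow_odd even_pow delta_def m_assoc)
  qed
qed

end

section \<open>The action on the free group\<close>

lemma carrier_ZxZ [simp]: "carrier ZxZ = UNIV"
  and one_ZxZ [simp]: "\<one>\<^bsub>ZxZ\<^esub> = (0, 0)"
  and mult_ZxZ [simp]: "(r1, s1) \<otimes>\<^bsub>ZxZ\<^esub> (r2, s2) = (r1 + (if even s1 then r2 else - r2), s1 + s2)"
  by (simp_all add: ZxZ_def)

lemma group_ZxZ: "group ZxZ"
proof (rule groupI)
  fix p :: "int \<times> int"
  obtain r s where p: "p = (r, s)" by (cases p)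
  show "\<exists>q\<in>carrier ZxZ. q \<otimes>\<^bsub>ZxZ\<^esub> p = \<one>\<^bsub>ZxZ\<^esub>"
    by (intro bexI[of _ "(if even s then - r else r, - s)"]) (auto simp: p)
qed auto

interpretation ZxZ: group ZxZ
  by (rule group_ZxZ)

lemma ZxZ_pow_1: "(1, 0) [^]\<^bsub>ZxZ\<^esub> (k :: int) = (k, 0)"
proof -
  have nat: "(1, 0) [^]\<^bsub>ZxZ\<^esub> (n :: nat) = (int n, 0)" for n
    by (induction n) (simp_all add: ZxZ.nat_pow_Suc)
  show ?thesis
    by (cases k) (auto simp: int_pow_int nat ZxZ.int_pow_neg_int simp del: of_nat_Suc
        intro!: ZxZ.inv_equality)
qed

lemma ZxZ_pow_2: "(0, 1) [^]\<^bsub>ZxZ\<^esub> (k :: int) = (0, k)"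
proof -
  have nat: "(0, 1) [^]\<^bsub>ZxZ\<^esub> (n :: nat) = (0, int n)" for n
    by (induction n) (simp_all add: ZxZ.nat_pow_Suc)
  show ?thesis
    by (cases k) (auto simp: int_pow_int nat ZxZ.int_pow_neg_int simp del: of_nat_Suc
        intro!: ZxZ.inv_equality)
qed

lemma generate_ZxZ: "generate ZxZ {(1, 0), (0, 1)} = carrier ZxZ"
proof -
  have "(m, n) \<in> generate ZxZ {(1, 0), (0, 1)}" for m n
  proof -
    have sub: "subgroup (generate ZxZ {(1, 0), (0, 1)}) ZxZ"
      by (rule ZxZ.generate_is_subgroup) simp
    have "(1, 0) [^]\<^bsub>ZxZ\<^esub> m \<otimes>\<^bsub>ZxZ\<^esub> (0, 1) [^]\<^bsub>ZxZ\<^esub> n \<in> generate ZxZ {(1, 0), (0, 1)}"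
      by (intro subgroup.m_closed[OF sub] ZxZ.subgroup_int_pow_closed[OF sub])
        (auto intro: generate.incl)
    then show ?thesis
      by (simp add: ZxZ_pow_1 ZxZ_pow_2)
  qed
  then show ?thesis
    by auto
qed

interpretation F: group Fuv
  unfolding Fuv_def by (rule group_presented_group)

lemma uF_closed [simp]: "uF \<in> carrier Fuv" and vF_closed [simp]: "vF \<in> carrier Fuv"
  by (simp_all add: uF_def vF_def Fuv_def)

lemma BF_closed [simp]: "BF \<in> carrier Fuv"
  by (simp add: BF_def)

lemma generate_Fuv: "generate Fuv {uF, vF} = carrier Fuv"
proof -
  have "range (gen_class {}) = {uF, vF}"
  proof -
    have UNIV_eq: "UNIV = {Gu, Gv}"
      by (auto intro: free_gen.exhaust)
    show ?thesis
      unfolding UNIV_eq uF_def vF_def by simp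
  qed
  then show ?thesis
    using generate_presented_group[of "{} :: (free_gen word \<times> free_gen word) set"]
    by (simp add: Fuv_def)
qed

declare theta.simps [simp del]

text \<open>
  The free group has no relations to respect, so that the prescribed images of \<open>u\<close> and \<open>v\<close> always
  extend to an endomorphism.
\<close>

lemma theta_hom_and_gens:
  shows theta_hom: "theta (m, n) \<in> hom Fuv Fuv"
    and theta_u: "theta (m, n) uF = BF [^]\<^bsub>Fuv\<^esub> (m - delta n)
        \<otimes>\<^bsub>Fuv\<^esub> uF [^]\<^bsub>Fuv\<^esub> (if even n then 1 else - 1 :: int) \<otimes>\<^bsub>Fuv\<^esub> BF [^]\<^bsub>Fuv\<^esub> (- m + delta n)"
    and theta_v: "theta (m, n) vF = BF [^]\<^bsub>Fuv\<^esub> m \<otimes>\<^bsub>Fuv\<^esub> vF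
        \<otimes>\<^bsub>Fuv\<^esub> uF [^]\<^bsub>Fuv\<^esub> (- 2 * m) \<otimes>\<^bsub>Fuv\<^esub> BF [^]\<^bsub>Fuv\<^esub> (- m + delta n)"
proof -
  let ?f = "\<lambda>x. case x of
        Gu \<Rightarrow> BF [^]\<^bsub>Fuv\<^esub> (m - delta n) \<otimes>\<^bsub>Fuv\<^esub> uF [^]\<^bsub>Fuv\<^esub> (if even n then 1 else - 1 :: int)
              \<otimes>\<^bsub>Fuv\<^esub> BF [^]\<^bsub>Fuv\<^esub> (- m + delta n)
      | Gv \<Rightarrow> BF [^]\<^bsub>Fuv\<^esub> m \<otimes>\<^bsub>Fuv\<^esub> vF \<otimes>\<^bsub>Fuv\<^esub> uF [^]\<^bsub>Fuv\<^esub> (- 2 * m)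
              \<otimes>\<^bsub>Fuv\<^esub> BF [^]\<^bsub>Fuv\<^esub> (- m + delta n)"
  have f: "range ?f \<subseteq> carrier Fuv"
    by (auto split: free_gen.split)
  have R: "eval_word Fuv ?f l = eval_word Fuv ?f r" if "(l, r) \<in> {}" for l r
    using that by simp
  have theta: "theta (m, n) = pres_lift Fuv ?f"
    by (rule theta.simps)
  show "theta (m, n) \<in> hom Fuv Fuv"
    unfolding theta using F.pres_lift_hom[OF f R] by (simp only: Fuv_def)
  show "theta (m, n) uF = BF [^]\<^bsub>Fuv\<^esub> (m - delta n)
        \<otimes>\<^bsub>Fuv\<^esub> uF [^]\<^bsub>Fuv\<^esub> (if even n then 1 else - 1 :: int) \<otimes>\<^bsub>Fuv\<^esub> BF [^]\<^bsub>Fuv\<^esub> (- m + delta n)"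
    unfolding theta
    using F.pres_lift_gen_class[OF f R, of "{}" Gu] by (simp add: uF_def)
  show "theta (m, n) vF = BF [^]\<^bsub>Fuv\<^esub> m \<otimes>\<^bsub>Fuv\<^esub> vF
        \<otimes>\<^bsub>Fuv\<^esub> uF [^]\<^bsub>Fuv\<^esub> (- 2 * m) \<otimes>\<^bsub>Fuv\<^esub> BF [^]\<^bsub>Fuv\<^esub> (- m + delta n)"
    unfolding theta
    using F.pres_lift_gen_class[OF f R, of "{}" Gv] by (simp add: vF_def)
qed

interpretation th: group_hom Fuv Fuv "theta (m, n)" for m n
  using theta_hom by unfold_locales

lemma theta_BF: "theta (m, n) BF = BF [^]\<^bsub>Fuv\<^esub> (if even n then 1 else - 1 :: int)"
proof -
  have B: "uF \<otimes>\<^bsub>Fuv\<^esub> vF \<otimes>\<^bsub>Fuv\<^esub> uF \<otimes>\<^bsub>Fuv\<^esub> inv\<^bsub>Fuv\<^esub> vF = BF"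
    by (simp add: BF_def)
  have hB: "theta (m, n) BF = theta (m, n) uF \<otimes>\<^bsub>Fuv\<^esub> theta (m, n) vF \<otimes>\<^bsub>Fuv\<^esub> theta (m, n) uF
      \<otimes>\<^bsub>Fuv\<^esub> inv\<^bsub>Fuv\<^esub> theta (m, n) vF"
    by (simp only: B[symmetric] th.hom_mult th.hom_inv F.m_closed F.inv_closed uF_closed vF_closed)
  define p where "p = BF [^]\<^bsub>Fuv\<^esub> m"
  define q where "q = uF [^]\<^bsub>Fuv\<^esub> (2 * m)"
  have [simp]: "p \<in> carrier Fuv" "q \<in> carrier Fuv"
    by (simp_all add: p_def q_def)
  have q_neg: "uF [^]\<^bsub>Fuv\<^esub> (- (2 * m)) = inv\<^bsub>Fuv\<^esub> q" and p_neg: "BF [^]\<^bsub>Fuv\<^esub> (- m) = inv\<^bsub>Fuv\<^esub> p"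
    by (simp_all only: q_def p_def F.int_pow_neg uF_closed BF_closed)
  have p_B: "p \<otimes>\<^bsub>Fuv\<^esub> BF = BF \<otimes>\<^bsub>Fuv\<^esub> p"
    unfolding p_def by (rule F.commute_int_pow) simp_all
  have q_u: "q \<otimes>\<^bsub>Fuv\<^esub> uF = uF \<otimes>\<^bsub>Fuv\<^esub> q"
    unfolding q_def by (rule F.commute_int_pow) simp_all
  show ?thesis
  proof (cases "even n")
    case True
    have "theta (m, n) BF = p \<otimes>\<^bsub>Fuv\<^esub> (uF \<otimes>\<^bsub>Fuv\<^esub> vF \<otimes>\<^bsub>Fuv\<^esub> (inv\<^bsub>Fuv\<^esub> q \<otimes>\<^bsub>Fuv\<^esub> (uF \<otimes>\<^bsub>Fuv\<^esub> q)) \<otimes>\<^bsub>Fuv\<^esub> inv\<^bsub>Fuv\<^esub> vF) \<otimes>\<^bsub>Fuv\<^esub> inv\<^bsub>Fuv\<^esub> p"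
      unfolding hB theta_u theta_v using True
      by (simp add: delta_def q_neg p_neg F.word_simps flip: p_def)
    moreover have "inv\<^bsub>Fuv\<^esub> q \<otimes>\<^bsub>Fuv\<^esub> (uF \<otimes>\<^bsub>Fuv\<^esub> q) = uF"
      by (simp add: q_u[symmetric] F.word_simps)
    ultimately have "theta (m, n) BF = p \<otimes>\<^bsub>Fuv\<^esub> BF \<otimes>\<^bsub>Fuv\<^esub> inv\<^bsub>Fuv\<^esub> p"
      by (simp only: B)
    then show ?thesis
      unfolding p_B using True by (simp add: F.m_assoc)
  next
    case False
    have e1: "BF [^]\<^bsub>Fuv\<^esub> (m - 1) = p \<otimes>\<^bsub>Fuv\<^esub> inv\<^bsub>Fuv\<^esub> BF"
      by (simp add: F.int_pow_diff p_def)
    have e2: "BF [^]\<^bsub>Fuv\<^esub> (1 - m) = BF \<otimes>\<^bsub>Fuv\<^esub> inv\<^bsub>Fuv\<^esub> p"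
      by (simp add: F.int_pow_diff p_def)
    have e3: "uF [^]\<^bsub>Fuv\<^esub> (-1 :: int) = inv\<^bsub>Fuv\<^esub> uF" "BF [^]\<^bsub>Fuv\<^esub> (-1 :: int) = inv\<^bsub>Fuv\<^esub> BF"
      using F.int_pow_neg[OF uF_closed, of 1] F.int_pow_neg[OF BF_closed, of 1] by simp_all
    have "theta (m, n) BF = p \<otimes>\<^bsub>Fuv\<^esub> (inv\<^bsub>Fuv\<^esub> BF \<otimes>\<^bsub>Fuv\<^esub> inv\<^bsub>Fuv\<^esub> uF \<otimes>\<^bsub>Fuv\<^esub> BF \<otimes>\<^bsub>Fuv\<^esub> vF
        \<otimes>\<^bsub>Fuv\<^esub> (inv\<^bsub>Fuv\<^esub> q \<otimes>\<^bsub>Fuv\<^esub> (inv\<^bsub>Fuv\<^esub> uF \<otimes>\<^bsub>Fuv\<^esub> q)) \<otimes>\<^bsub>Fuv\<^esub> inv\<^bsub>Fuv\<^esub> vF) \<otimes>\<^bsub>Fuv\<^esub> inv\<^bsub>Fuv\<^esub> p"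
      unfolding hB theta_u theta_v using False
      by (simp add: delta_def q_neg e1 e2 e3 F.word_simps flip: p_def)
    moreover have "inv\<^bsub>Fuv\<^esub> q \<otimes>\<^bsub>Fuv\<^esub> (inv\<^bsub>Fuv\<^esub> uF \<otimes>\<^bsub>Fuv\<^esub> q) = inv\<^bsub>Fuv\<^esub> uF"
      by (simp add: F.conj_inv[OF q_u, symmetric] F.word_simps)
    moreover have "inv\<^bsub>Fuv\<^esub> BF \<otimes>\<^bsub>Fuv\<^esub> inv\<^bsub>Fuv\<^esub> uF \<otimes>\<^bsub>Fuv\<^esub> BF \<otimes>\<^bsub>Fuv\<^esub> vF \<otimes>\<^bsub>Fuv\<^esub> inv\<^bsub>Fuv\<^esub> uF \<otimes>\<^bsub>Fuv\<^esub> inv\<^bsub>Fuv\<^esub> vF = inv\<^bsub>Fuv\<^esub> BF"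
      by (simp add: BF_def F.word_simps)
    ultimately have "theta (m, n) BF = p \<otimes>\<^bsub>Fuv\<^esub> inv\<^bsub>Fuv\<^esub> BF \<otimes>\<^bsub>Fuv\<^esub> inv\<^bsub>Fuv\<^esub> p"
      by (simp only:)
    then show ?thesis
      unfolding F.conj_inv[OF p_B, simplified] using False by (simp add: e3 F.m_assoc)
  qed
qed

lemma delta_add: "delta (n + n') = delta n + (if even n then delta n' else - delta n')"
  by (simp add: delta_def)

text \<open>
  Both sides are endomorphisms, so that it is enough to compare them on \<open>u\<close> and \<open>v\<close>. There the
  powers of \<open>B\<close> collect by \<open>theta_BF\<close>, and the exponents agree by \<open>delta_add\<close>.
\<close>

lemma theta_comp:
  assumes w: "w \<in> carrier Fuv"
  shows "theta (m + (if even n then m' else - m'), n + n') w = theta (m, n) (theta (m', n') w)"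
proof -
  define e where "e = (if even n then 1 else - 1 :: int)"
  define e' where "e' = (if even n' then 1 else - 1 :: int)"
  define d where "d = delta n"
  define d' where "d' = delta n'"
  have m: "m + (if even n then m' else - m') = m + e * m'" and d: "delta (n + n') = d + e * d'"
    and e: "(if even (n + n') then 1 else - 1 :: int) = e * e'"
    by (simp_all add: e_def e'_def d_def d'_def delta_add)
  have B: "theta (m, n) (BF [^]\<^bsub>Fuv\<^esub> k) = BF [^]\<^bsub>Fuv\<^esub> (e * k)" for k :: int
    by (simp add: th.hom_int_pow theta_BF F.int_pow_pow e_def)
  have u: "theta (m, n) (uF [^]\<^bsub>Fuv\<^esub> k) =
      BF [^]\<^bsub>Fuv\<^esub> (m - d) \<otimes>\<^bsub>Fuv\<^esub> uF [^]\<^bsub>Fuv\<^esub> (e * k) \<otimes>\<^bsub>Fuv\<^esub> BF [^]\<^bsub>Fuv\<^esub> (- m + d)" for k :: int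
  proof -
    have neg: "BF [^]\<^bsub>Fuv\<^esub> (- m + d) = inv\<^bsub>Fuv\<^esub> (BF [^]\<^bsub>Fuv\<^esub> (m - d))"
      using F.int_pow_neg[OF BF_closed, of "m - d"] by simp
    have "theta (m, n) uF = BF [^]\<^bsub>Fuv\<^esub> (m - d) \<otimes>\<^bsub>Fuv\<^esub> uF [^]\<^bsub>Fuv\<^esub> e \<otimes>\<^bsub>Fuv\<^esub> inv\<^bsub>Fuv\<^esub> (BF [^]\<^bsub>Fuv\<^esub> (m - d))"
      unfolding theta_u d_def[symmetric] e_def[symmetric] neg ..
    then show ?thesis
      unfolding neg by (simp add: th.hom_int_pow F.int_pow_conj F.int_pow_pow)
  qed
  have "theta (m + e * m', n + n') uF = theta (m, n) (theta (m', n') uF)"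
  proof -
    have "theta (m, n) (theta (m', n') uF) =
        BF [^]\<^bsub>Fuv\<^esub> (e * (m' - d')) \<otimes>\<^bsub>Fuv\<^esub> (BF [^]\<^bsub>Fuv\<^esub> (m - d) \<otimes>\<^bsub>Fuv\<^esub> uF [^]\<^bsub>Fuv\<^esub> (e * e')
          \<otimes>\<^bsub>Fuv\<^esub> BF [^]\<^bsub>Fuv\<^esub> (- m + d)) \<otimes>\<^bsub>Fuv\<^esub> BF [^]\<^bsub>Fuv\<^esub> (e * (- m' + d'))"
      unfolding theta_u[of m' n'] d'_def[symmetric] e'_def[symmetric]
      by (simp only: th.hom_mult B u F.m_closed F.int_pow_closed uF_closed BF_closed)
    also have "\<dots> = (BF [^]\<^bsub>Fuv\<^esub> (e * (m' - d')) \<otimes>\<^bsub>Fuv\<^esub> BF [^]\<^bsub>Fuv\<^esub> (m - d)) \<otimes>\<^bsub>Fuv\<^esub> uF [^]\<^bsub>Fuv\<^esub> (e * e')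
          \<otimes>\<^bsub>Fuv\<^esub> (BF [^]\<^bsub>Fuv\<^esub> (- m + d) \<otimes>\<^bsub>Fuv\<^esub> BF [^]\<^bsub>Fuv\<^esub> (e * (- m' + d')))"
      by (simp add: F.m_assoc)
    also have "\<dots> = theta (m + e * m', n + n') uF"
      unfolding theta_u e d by (simp add: algebra_simps flip: F.int_pow_mult)
    finally show ?thesis by simp
  qed
  moreover have "theta (m + e * m', n + n') vF = theta (m, n) (theta (m', n') vF)"
  proof -
    have "theta (m, n) (theta (m', n') vF) =
        BF [^]\<^bsub>Fuv\<^esub> (e * m') \<otimes>\<^bsub>Fuv\<^esub> (BF [^]\<^bsub>Fuv\<^esub> m \<otimes>\<^bsub>Fuv\<^esub> vF \<otimes>\<^bsub>Fuv\<^esub> uF [^]\<^bsub>Fuv\<^esub> (- 2 * m)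
            \<otimes>\<^bsub>Fuv\<^esub> BF [^]\<^bsub>Fuv\<^esub> (- m + d))
          \<otimes>\<^bsub>Fuv\<^esub> (BF [^]\<^bsub>Fuv\<^esub> (m - d) \<otimes>\<^bsub>Fuv\<^esub> uF [^]\<^bsub>Fuv\<^esub> (e * (- 2 * m')) \<otimes>\<^bsub>Fuv\<^esub> BF [^]\<^bsub>Fuv\<^esub> (- m + d))
          \<otimes>\<^bsub>Fuv\<^esub> BF [^]\<^bsub>Fuv\<^esub> (e * (- m' + d'))"
      unfolding theta_v[of m' n'] d'_def[symmetric]
      by (simp only: th.hom_mult B u theta_v d_def[symmetric] F.m_closed F.int_pow_closed uF_closed vF_closed BF_closed)
    also have "\<dots> = (BF [^]\<^bsub>Fuv\<^esub> (e * m') \<otimes>\<^bsub>Fuv\<^esub> BF [^]\<^bsub>Fuv\<^esub> m) \<otimes>\<^bsub>Fuv\<^esub> vF \<otimes>\<^bsub>Fuv\<^esub> (uF [^]\<^bsub>Fuv\<^esub> (- 2 * m)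
            \<otimes>\<^bsub>Fuv\<^esub> ((BF [^]\<^bsub>Fuv\<^esub> (- m + d) \<otimes>\<^bsub>Fuv\<^esub> BF [^]\<^bsub>Fuv\<^esub> (m - d)) \<otimes>\<^bsub>Fuv\<^esub> uF [^]\<^bsub>Fuv\<^esub> (e * (- 2 * m'))))
          \<otimes>\<^bsub>Fuv\<^esub> (BF [^]\<^bsub>Fuv\<^esub> (- m + d) \<otimes>\<^bsub>Fuv\<^esub> BF [^]\<^bsub>Fuv\<^esub> (e * (- m' + d')))"
      by (simp add: F.m_assoc)
    also have "\<dots> = theta (m + e * m', n + n') vF"
      by (simp add: theta_v d algebra_simps flip: F.int_pow_mult)
    finally show ?thesis by simp
  qed
  moreover have comp_hom: "theta (m, n) \<circ> theta (m', n') \<in> hom Fuv Fuv"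
    by (rule hom_compose[OF theta_hom theta_hom])
  ultimately have on_gens: "theta (m + e * m', n + n') x = (theta (m, n) \<circ> theta (m', n')) x"
    if "x \<in> {uF, vF}" for x
    using that by auto
  have "theta (m + e * m', n + n') w = (theta (m, n) \<circ> theta (m', n')) w"
    by (rule hom_eq_on_generators[OF F.is_group F.is_group theta_hom comp_hom _ on_gens, where S = "{uF, vF}"])
      (simp_all add: generate_Fuv w)
  then show ?thesis
    by (simp add: m)
qed

lemma theta_0:
  assumes "w \<in> carrier Fuv"
  shows "theta (0, 0) w = w"
proof -
  have id_hom: "id \<in> hom Fuv Fuv"
    by (simp add: hom_def)
  have on_gens: "theta (0, 0) x = id x" if "x \<in> {uF, vF}" for x
    using that by (auto simp: theta_u theta_v delta_def)
  have "theta (0, 0) w = id w"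
    by (rule hom_eq_on_generators[OF F.is_group F.is_group theta_hom id_hom _ on_gens, where S = "{uF, vF}"])
      (simp_all add: generate_Fuv assms)
  then show ?thesis
    by simp
qed

interpretation theta_action: group_action_by_homs Fuv ZxZ theta
proof unfold_locales
  fix g assume "g \<in> carrier ZxZ"
  then show "theta g \<in> hom Fuv Fuv"
    using theta_hom by (cases g) simp
next
  fix g h w assume "w \<in> carrier Fuv"
  then show "theta (g \<otimes>\<^bsub>ZxZ\<^esub> h) w = theta g (theta h w)"
    by (cases g; cases h) (simp only: mult_ZxZ theta_comp)
next
  fix w assume "w \<in> carrier Fuv"
  then show "theta \<one>\<^bsub>ZxZ\<^esub> w = w"
    by (simp only: one_ZxZ theta_0)
qed

lemma generate_SD:
  "generate SD {(uF, 0, 0), (vF, 0, 0), (\<one>\<^bsub>Fuv\<^esub>, 1, 0), (\<one>\<^bsub>Fuv\<^esub>, 0, 1)} = carrier SD"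
proof -
  have "{(uF, 0, 0), (vF, 0, 0), (\<one>\<^bsub>Fuv\<^esub>, 1, 0), (\<one>\<^bsub>Fuv\<^esub>, 0, 1)} =
      (\<lambda>w. (w, \<one>\<^bsub>ZxZ\<^esub>)) ` {uF, vF} \<union> (\<lambda>g. (\<one>\<^bsub>Fuv\<^esub>, g)) ` {(1, 0), (0, 1)}"
    by auto
  then show ?thesis
    using theta_action.generate_semidirect[OF generate_Fuv _ generate_ZxZ] by (simp add: SD_def)
qed

section \<open>From the semi-direct product to the braid group\<close>

interpretation SD: group SD
  unfolding SD_def by (rule theta_action.group_semidirect)

lemma SD_carrier [simp]: "p \<in> carrier SD \<longleftrightarrow> fst p \<in> carrier Fuv"
  by (cases p) (simp add: SD_def)

lemma SD_mult: "(w, m, n) \<otimes>\<^bsub>SD\<^esub> (w', m', n') =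
    (w \<otimes>\<^bsub>Fuv\<^esub> theta (m, n) w', m + (if even n then m' else - m'), n + n')"
  by (simp add: SD_def)

lemma SD_one: "\<one>\<^bsub>SD\<^esub> = (\<one>\<^bsub>Fuv\<^esub>, 0, 0)"
  by (simp add: SD_def)

lemma klein_relations_explicit:
  "klein_relations =
    {([(Gsigma, False), (Ga1, True), (Gsigma, False), (Ga1, True)],
      [(Ga1, True), (Gsigma, False), (Ga1, True), (Gsigma, True)]),
     ([(Gsigma, False), (Ga2, True), (Gsigma, False), (Ga2, True)],
      [(Ga2, True), (Gsigma, False), (Ga2, True), (Gsigma, True)]),
     ([(Gsigma, False), (Ga1, True), (Gsigma, True), (Ga2, True)],
      [(Ga2, True), (Gsigma, False), (Ga1, True), (Gsigma, True)]),
     ([(Ga1, True), (Ga1, True), (Ga2, True), (Ga2, True)],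
      [(Gsigma, True), (Gsigma, True)])}"
  by (simp add: klein_relations_def Let_def)

interpretation K: klein_bottle_braids B2K a1K a2K sigmaK
proof -
  interpret group B2K
    unfolding B2K_def by (rule group_presented_group)
  define g where "g = gen_class klein_relations"
  have [simp]: "g x \<in> carrier B2K" for x
    by (simp add: B2K_def g_def)
  have gens: "a1K = g Ga1" "a2K = g Ga2" "sigmaK = g Gsigma"
    by (simp_all add: a1K_def a2K_def sigmaK_def g_def)
  have "\<forall>(l, r) \<in> klein_relations. eval_word B2K g l = eval_word B2K g r"
    using eval_word_relation[of _ _ klein_relations] by (auto simp: B2K_def g_def)
  note this[unfolded klein_relations_explicit]
  then show "klein_bottle_braids B2K a1K a2K sigmaK"
    unfolding gens by unfold_locales (simp_all add: m_assoc)
qed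

lemma K_b: "K.b1 = b1K" "K.b2 = b2K"
  by (simp_all add: K.b1_def K.b2_def b1K_def b2K_def)

text \<open>
  The homomorphism \<open>\<lambda>\<close> in explicit form: \<open>phi\<close> and \<open>rho\<close> are its restrictions to the two
  factors, and \<open>lam\<close> is their product.
\<close>

definition phi :: "free_gen word set \<Rightarrow> braid_gen word set" where
  "phi = pres_lift B2K (case_free_gen K.u K.v)"

definition rho :: "int \<times> int \<Rightarrow> braid_gen word set" where
  "rho = (\<lambda>(m, n). K.X [^]\<^bsub>B2K\<^esub> m \<otimes>\<^bsub>B2K\<^esub> K.Y [^]\<^bsub>B2K\<^esub> n)"

definition lam :: "sd_elem \<Rightarrow> braid_gen word set" where
  "lam = (\<lambda>(w, g). phi w \<otimes>\<^bsub>B2K\<^esub> rho g)"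

lemma phi_hom: "phi \<in> hom Fuv B2K"
  and phi_u: "phi uF = K.u" and phi_v: "phi vF = K.v"
proof -
  have f: "range (case_free_gen K.u K.v) \<subseteq> carrier B2K"
    by (auto split: free_gen.split)
  have R: "eval_word B2K (case_free_gen K.u K.v) l = eval_word B2K (case_free_gen K.u K.v) r"
    if "(l, r) \<in> {}" for l r
    using that by simp
  show "phi \<in> hom Fuv B2K"
    unfolding phi_def using K.pres_lift_hom[OF f R] by (simp only: Fuv_def)
  show "phi uF = K.u" "phi vF = K.v"
    unfolding phi_def uF_def vF_def
    using K.pres_lift_gen_class[OF f R, of "{}" Gu] K.pres_lift_gen_class[OF f R, of "{}" Gv]
    by simp_all
qed

interpretation phi: group_hom Fuv B2K phi
  using phi_hom by unfold_locales

lemma phi_B: "phi BF = K.B"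
  by (simp add: BF_def phi_u phi_v K.B_eq_uv)

lemma rho_hom: "rho \<in> hom ZxZ B2K"
proof (rule homI)
  fix g h :: "int \<times> int"
  obtain m n m' n' where gh: "g = (m, n)" "h = (m', n')"
    by (cases g; cases h)
  define e where "e = (if even n then m' else - m')"
  have "rho g \<otimes>\<^bsub>B2K\<^esub> rho h = K.X [^]\<^bsub>B2K\<^esub> m \<otimes>\<^bsub>B2K\<^esub> (K.Y [^]\<^bsub>B2K\<^esub> n \<otimes>\<^bsub>B2K\<^esub> K.X [^]\<^bsub>B2K\<^esub> m') \<otimes>\<^bsub>B2K\<^esub> K.Y [^]\<^bsub>B2K\<^esub> n'"
    by (simp add: gh rho_def K.m_assoc)
  also have "\<dots> = rho (g \<otimes>\<^bsub>ZxZ\<^esub> h)"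
    unfolding gh mult_ZxZ K.inverting_int_pow[OF K.Y_X K.more_closed(8,9)] e_def[symmetric]
    by (simp add: rho_def K.int_pow_mult K.m_assoc)
  finally show "rho (g \<otimes>\<^bsub>ZxZ\<^esub> h) = rho g \<otimes>\<^bsub>B2K\<^esub> rho h" ..
qed (auto simp: rho_def)

text \<open>
  Compatibility with the action on the four pairs of generators is \<open>X_u\<close>, \<open>X_v\<close>, \<open>Y_u\<close> and
  \<open>Y_v\<close>.
\<close>

lemma lam_hom: "lam \<in> hom SD B2K"
proof -
  have rho_gens: "rho (1, 0) = K.X" "rho (0, 1) = K.Y"
    by (simp_all add: rho_def)
  have neg: "x [^]\<^bsub>B2K\<^esub> (-1 :: int) = inv\<^bsub>B2K\<^esub> x" "x [^]\<^bsub>B2K\<^esub> (-2 :: int) = inv\<^bsub>B2K\<^esub> x \<otimes>\<^bsub>B2K\<^esub> inv\<^bsub>B2K\<^esub> x"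
    if "x \<in> carrier B2K" for x
    using that K.int_pow_neg[of x 1] K.int_pow_neg[of x 2]
    by (simp_all add: K.int_pow_2 K.inv_mult_group)
  have compat: "rho g \<otimes>\<^bsub>B2K\<^esub> phi w = phi (theta g w) \<otimes>\<^bsub>B2K\<^esub> rho g"
    if "g \<in> {(1, 0), (0, 1)}" "w \<in> {uF, vF}" for g w
    using that K.X_u K.X_v K.Y_u K.Y_v
    by (auto simp: rho_gens theta_u theta_v delta_def phi_u phi_v phi_B phi.hom_int_pow neg K.m_assoc)
  show ?thesis
    unfolding lam_def SD_def
    by (rule theta_action.semidirect_hom[OF K.is_group phi_hom rho_hom generate_Fuv _ generate_ZxZ _ compat]) auto
qed

interpretation lam: group_hom SD B2K lam
  using lam_hom by unfold_locales

lemma lam_pow: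
  assumes "w \<in> carrier Fuv"
  shows "lam (w, m, n) = phi w \<otimes>\<^bsub>B2K\<^esub> K.X [^]\<^bsub>B2K\<^esub> m \<otimes>\<^bsub>B2K\<^esub> K.Y [^]\<^bsub>B2K\<^esub> n"
  using assms by (simp add: lam_def rho_def K.m_assoc)

section \<open>Injectivity by a representation in a wreath product\<close>

text \<open>
  The wreath product of \<open>G\<close> with the group of order two. The flag of the left factor decides
  whether the components of the right factor are exchanged; this is the convention for the action
  on right cosets, with \<open>t\<^sub>i g = h\<^sub>i t\<^sub>i\<^sub>g\<close> for representatives \<open>t\<^sub>i\<close>.
\<close>

definition wreath_Z2 :: "('a, 'm) monoid_scheme \<Rightarrow> (('a \<times> 'a) \<times> bool) monoid" where
  "wreath_Z2 G = \<lparr>carrier = (carrier G \<times> carrier G) \<times> UNIV,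
     monoid.mult = (\<lambda>((x, y), e) ((x', y'), e').
       (if e then (x \<otimes>\<^bsub>G\<^esub> y', y \<otimes>\<^bsub>G\<^esub> x') else (x \<otimes>\<^bsub>G\<^esub> x', y \<otimes>\<^bsub>G\<^esub> y'), e \<noteq> e')),
     one = ((\<one>\<^bsub>G\<^esub>, \<one>\<^bsub>G\<^esub>), False)\<rparr>"

lemma wreath_Z2_simps [simp]:
  "carrier (wreath_Z2 G) = (carrier G \<times> carrier G) \<times> UNIV"
  "((x, y), e) \<otimes>\<^bsub>wreath_Z2 G\<^esub> ((x', y'), e') =
     (if e then (x \<otimes>\<^bsub>G\<^esub> y', y \<otimes>\<^bsub>G\<^esub> x') else (x \<otimes>\<^bsub>G\<^esub> x', y \<otimes>\<^bsub>G\<^esub> y'), e \<noteq> e')"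
  "\<one>\<^bsub>wreath_Z2 G\<^esub> = ((\<one>\<^bsub>G\<^esub>, \<one>\<^bsub>G\<^esub>), False)"
  by (simp_all add: wreath_Z2_def)

lemma (in group) group_wreath_Z2: "group (wreath_Z2 G)"
proof (rule groupI)
  fix p assume "p \<in> carrier (wreath_Z2 G)"
  then obtain x y e where p: "p = ((x, y), e)" "x \<in> carrier G" "y \<in> carrier G"
    by auto
  then show "\<exists>q\<in>carrier (wreath_Z2 G). q \<otimes>\<^bsub>wreath_Z2 G\<^esub> p = \<one>\<^bsub>wreath_Z2 G\<^esub>"
    by (intro bexI[of _ "(if e then (inv y, inv x) else (inv x, inv y), e)"]) auto
qed (auto simp: m_assoc)

lemma (in group) inv_wreath_Z2:
  assumes "x \<in> carrier G" "y \<in> carrier G"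
  shows "inv\<^bsub>wreath_Z2 G\<^esub> ((x, y), e) = (if e then (inv y, inv x) else (inv x, inv y), e)"
  using assms by (intro group.inv_equality[OF group_wreath_Z2]) auto

interpretation W: group "wreath_Z2 SD"
  by (rule SD.group_wreath_Z2)

text \<open>
  The images of \<open>a\<^sub>1\<close>, \<open>a\<^sub>2\<close>, \<open>b\<^sub>1\<close>, \<open>b\<^sub>2\<close> and \<open>B\<close> under \<open>\<gamma>\<close>.
\<close>

definition SD_a1 :: sd_elem where "SD_a1 = (inv\<^bsub>Fuv\<^esub> vF \<otimes>\<^bsub>Fuv\<^esub> inv\<^bsub>Fuv\<^esub> uF, 1, 1)"
definition SD_a2 :: sd_elem where "SD_a2 = (vF, 0, - 1)"
definition SD_b1 :: sd_elem where "SD_b1 = (uF \<otimes>\<^bsub>Fuv\<^esub> vF, 0, 0)"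
definition SD_b2 :: sd_elem where "SD_b2 = (inv\<^bsub>Fuv\<^esub> vF, 0, 0)"
definition SD_B :: sd_elem where "SD_B = (BF, 0, 0)"

lemma SD_gens_closed [simp]:
  "SD_a1 \<in> carrier SD" "SD_a2 \<in> carrier SD" "SD_b1 \<in> carrier SD" "SD_b2 \<in> carrier SD" "SD_B \<in> carrier SD"
  by (simp_all add: SD_a1_def SD_a2_def SD_b1_def SD_b2_def SD_B_def)

lemma inv_BF_SD: "inv\<^bsub>SD\<^esub> (BF, 0, 0) = (inv\<^bsub>Fuv\<^esub> BF, 0, 0)"
  by (rule SD.inv_equality) (simp_all add: SD_mult SD_one theta_0)

lemma F_pow_neg:
  assumes "x \<in> carrier Fuv"
  shows "x [^]\<^bsub>Fuv\<^esub> (-1 :: int) = inv\<^bsub>Fuv\<^esub> x"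
    and "x [^]\<^bsub>Fuv\<^esub> (-2 :: int) = inv\<^bsub>Fuv\<^esub> x \<otimes>\<^bsub>Fuv\<^esub> inv\<^bsub>Fuv\<^esub> x"
  using assms F.int_pow_neg[of x 1] F.int_pow_neg[of x 2]
  by (simp_all add: F.int_pow_2 F.inv_mult_group)

lemmas SD_eval = SD_a1_def SD_a2_def SD_b1_def SD_b2_def SD_B_def inv_BF_SD SD_mult theta_0 theta_u theta_v theta_BF
  delta_def F_pow_neg F.int_pow_2

text \<open>
  The defining relations of the braid group, evaluated in both components of the wreath product:
  the relations between pure braids together with their conjugates by \<open>\<sigma>\<close>.
\<close>

lemma SD_relations:
  shows "SD_b1 \<otimes>\<^bsub>SD\<^esub> SD_a1 = SD_a1 \<otimes>\<^bsub>SD\<^esub> inv\<^bsub>SD\<^esub> SD_B \<otimes>\<^bsub>SD\<^esub> SD_b1"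
    and "SD_b2 \<otimes>\<^bsub>SD\<^esub> SD_a2 = SD_a2 \<otimes>\<^bsub>SD\<^esub> inv\<^bsub>SD\<^esub> SD_B \<otimes>\<^bsub>SD\<^esub> SD_b2"
    and "inv\<^bsub>SD\<^esub> SD_B \<otimes>\<^bsub>SD\<^esub> SD_b1 \<otimes>\<^bsub>SD\<^esub> SD_a1 = SD_a1 \<otimes>\<^bsub>SD\<^esub> inv\<^bsub>SD\<^esub> SD_B \<otimes>\<^bsub>SD\<^esub> SD_b1 \<otimes>\<^bsub>SD\<^esub> SD_B"
    and "inv\<^bsub>SD\<^esub> SD_B \<otimes>\<^bsub>SD\<^esub> SD_b2 \<otimes>\<^bsub>SD\<^esub> SD_a2 = SD_a2 \<otimes>\<^bsub>SD\<^esub> inv\<^bsub>SD\<^esub> SD_B \<otimes>\<^bsub>SD\<^esub> SD_b2 \<otimes>\<^bsub>SD\<^esub> SD_B"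
    and "SD_a1 \<otimes>\<^bsub>SD\<^esub> SD_b2 = SD_b2 \<otimes>\<^bsub>SD\<^esub> SD_a1"
    and "inv\<^bsub>SD\<^esub> SD_B \<otimes>\<^bsub>SD\<^esub> SD_b1 \<otimes>\<^bsub>SD\<^esub> SD_B \<otimes>\<^bsub>SD\<^esub> SD_a2 = SD_a2 \<otimes>\<^bsub>SD\<^esub> inv\<^bsub>SD\<^esub> SD_B \<otimes>\<^bsub>SD\<^esub> SD_b1 \<otimes>\<^bsub>SD\<^esub> SD_B"
    and "SD_a1 \<otimes>\<^bsub>SD\<^esub> SD_a1 \<otimes>\<^bsub>SD\<^esub> SD_a2 \<otimes>\<^bsub>SD\<^esub> SD_a2 = SD_B"
    and "SD_b1 \<otimes>\<^bsub>SD\<^esub> SD_b1 \<otimes>\<^bsub>SD\<^esub> SD_b2 \<otimes>\<^bsub>SD\<^esub> SD_b2 = SD_B"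
  by (simp add: SD_eval, (simp add: BF_def F.word_simps)?)+

text \<open>
  The induced representation with respect to the representatives \<open>1\<close> and \<open>\<sigma>\<close>. Right multiplication by \<open>\<sigma>\<close> takes
  \<open>1\<close> to \<open>\<sigma>\<close> and \<open>\<sigma>\<close> to \<open>B\<close>, whence the components \<open>1\<close> and \<open>B\<close>; and \<open>\<sigma>a\<^sub>i = b\<^sub>i\<sigma>\<close> gives the
  components \<open>a\<^sub>i\<close> and \<open>b\<^sub>i\<close> of \<open>a\<^sub>i\<close>.
\<close>

definition psi :: "braid_gen word set \<Rightarrow> (sd_elem \<times> sd_elem) \<times> bool" where
  "psi = pres_lift (wreath_Z2 SD)
     (case_braid_gen ((SD_a1, SD_b1), False) ((SD_a2, SD_b2), False) ((\<one>\<^bsub>SD\<^esub>, SD_B), True))"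

lemma psi_hom: "psi \<in> hom B2K (wreath_Z2 SD)"
  and psi_a1: "psi a1K = ((SD_a1, SD_b1), False)"
  and psi_a2: "psi a2K = ((SD_a2, SD_b2), False)"
  and psi_sigma: "psi sigmaK = ((\<one>\<^bsub>SD\<^esub>, SD_B), True)"
proof -
  let ?f = "case_braid_gen ((SD_a1, SD_b1), False) ((SD_a2, SD_b2), False) ((\<one>\<^bsub>SD\<^esub>, SD_B), True)"
  have f: "range ?f \<subseteq> carrier (wreath_Z2 SD)"
  proof -
    have "?f x \<in> carrier (wreath_Z2 SD)" for x
      by (cases x) (simp_all del: SD_carrier)
    then show ?thesis
      by blast
  qed
  have R: "eval_word (wreath_Z2 SD) ?f l = eval_word (wreath_Z2 SD) ?f r"
    if "(l, r) \<in> klein_relations" for l r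
    using that SD_relations
    by (auto simp: klein_relations_explicit SD.inv_wreath_Z2 SD.m_assoc simp del: SD_carrier)
  show "psi \<in> hom B2K (wreath_Z2 SD)"
    unfolding psi_def using W.pres_lift_hom[OF f R] by (simp only: B2K_def)
  show "psi a1K = ((SD_a1, SD_b1), False)" "psi a2K = ((SD_a2, SD_b2), False)" "psi sigmaK = ((\<one>\<^bsub>SD\<^esub>, SD_B), True)"
    unfolding psi_def a1K_def a2K_def sigmaK_def
    by (simp_all only: W.pres_lift_gen_class[OF f R] braid_gen.case)
qed

interpretation psi: group_hom B2K "wreath_Z2 SD" psi
  using psi_hom by unfold_locales

text \<open>
  This relation expresses \<open>\<gamma>(g) = p\<close> before \<open>\<gamma>\<close> is available. The second
  component would be \<open>l\<^sub>\<sigma>(p)\<close>; it is left open because no formula for it on arbitrary elements is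
  needed to prove stability under products and inverses.
\<close>

definition covers :: "sd_elem \<Rightarrow> braid_gen word set \<Rightarrow> bool" where
  "covers p g \<longleftrightarrow> (\<exists>q\<in>carrier SD. psi g = ((p, q), False))"

lemma covers_mult:
  assumes "covers p g" "covers q h" "g \<in> carrier B2K" "h \<in> carrier B2K"
  shows "covers (p \<otimes>\<^bsub>SD\<^esub> q) (g \<otimes>\<^bsub>B2K\<^esub> h)"
  using assms by (auto simp: covers_def simp del: SD_carrier intro!: SD.m_closed)

lemma covers_inv:
  assumes "covers p g" "g \<in> carrier B2K" "p \<in> carrier SD"
  shows "covers (inv\<^bsub>SD\<^esub> p) (inv\<^bsub>B2K\<^esub> g)"
  using assms by (auto simp: covers_def SD.inv_wreath_Z2 simp del: SD_carrier)

lemma covers_one: "covers \<one>\<^bsub>SD\<^esub> \<one>\<^bsub>B2K\<^esub>"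
  by (auto simp: covers_def simp del: SD_carrier)

lemma covers_gens: "covers SD_a1 a1K" "covers SD_a2 a2K" "covers SD_b1 K.b1" "covers SD_b2 K.b2"
  by (auto simp: covers_def psi_a1 psi_a2 psi_sigma K.b1_def K.b2_def SD.inv_wreath_Z2 SD.m_assoc
      simp del: SD_carrier)

lemma lam_gens: "lam (uF, 0, 0) = K.u" "lam (vF, 0, 0) = K.v"
  "lam (\<one>\<^bsub>Fuv\<^esub>, 1, 0) = K.X" "lam (\<one>\<^bsub>Fuv\<^esub>, 0, 1) = K.Y"
  by (simp_all add: lam_pow phi_u phi_v)

lemma inv_SD_a2: "inv\<^bsub>SD\<^esub> SD_a2 = (inv\<^bsub>Fuv\<^esub> BF \<otimes>\<^bsub>Fuv\<^esub> inv\<^bsub>Fuv\<^esub> vF, 0, 1)"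
  by (rule SD.inv_equality) (simp_all add: SD_eval SD_one F.word_simps)

lemma inv_SD_b2: "inv\<^bsub>SD\<^esub> SD_b2 = (vF, 0, 0)"
  by (rule SD.inv_equality) (simp_all add: SD_eval SD_one F.word_simps)

text \<open>
  The four generators are covered by the words in \<open>a\<^sub>i\<close> and \<open>b\<^sub>i\<close> that define their images, which
  evaluate in the semi-direct product to the generators themselves.
\<close>

lemma covers_lam:
  assumes "p \<in> carrier SD"
  shows "covers p (lam p)"
proof -
  let ?S = "{(uF, 0, 0), (vF, 0, 0), (\<one>\<^bsub>Fuv\<^esub>, 1, 0), (\<one>\<^bsub>Fuv\<^esub>, 0, 1)}"
  have S: "?S \<subseteq> carrier SD"
    by auto
  have "covers (SD_b1 \<otimes>\<^bsub>SD\<^esub> SD_b2) K.u" "covers (inv\<^bsub>SD\<^esub> SD_b2) K.v"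
    "covers (SD_b1 \<otimes>\<^bsub>SD\<^esub> SD_a1 \<otimes>\<^bsub>SD\<^esub> SD_b2 \<otimes>\<^bsub>SD\<^esub> SD_a2) K.X" "covers (inv\<^bsub>SD\<^esub> SD_a2 \<otimes>\<^bsub>SD\<^esub> inv\<^bsub>SD\<^esub> SD_b2) K.Y"
    unfolding K.u_def K.v_def K.X_def K.Y_def
    by (intro covers_mult covers_inv covers_gens K.m_closed K.inv_closed K.closed K.more_closed
        SD_gens_closed)+
  then have gens: "covers p (lam p)" if "p \<in> ?S" for p
    using that unfolding inv_SD_a2 inv_SD_b2 by (auto simp: lam_gens SD_eval F.word_simps)
  from assms have "p \<in> generate SD ?S"
    by (simp only: generate_SD)
  then show ?thesis
  proof induction
    case (inv p)
    then have "p \<in> carrier SD"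
      using S by blast
    then show ?case
      using covers_inv[OF gens[OF inv]] by (simp del: SD_carrier)
  next
    case (eng p q)
    then have "p \<in> carrier SD" "q \<in> carrier SD"
      by (simp_all only: generate_SD)
    then show ?case
      using covers_mult[OF eng.IH] by (simp del: SD_carrier)
  qed (use gens covers_one in \<open>simp_all del: insert_iff\<close>)
qed

lemma inj_lam: "inj_on lam (carrier SD)"
proof (rule inj_onI)
  fix p q assume pq: "p \<in> carrier SD" "q \<in> carrier SD" "lam p = lam q"
  obtain p' where p': "psi (lam p) = ((p, p'), False)"
    using covers_lam[OF pq(1)] unfolding covers_def by blast
  obtain q' where q': "psi (lam q) = ((q, q'), False)"
    using covers_lam[OF pq(2)] unfolding covers_def by blast
  from p' q' show "p = q"
    unfolding pq(3) by simp
qed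

lemma lam_values: "lam SD_a1 = a1K" "lam SD_a2 = a2K" "lam SD_b1 = K.b1" "lam SD_b2 = K.b2" "lam SD_B = K.B"
proof -
  have neg: "K.Y [^]\<^bsub>B2K\<^esub> (-1 :: int) = inv\<^bsub>B2K\<^esub> K.Y"
    using K.int_pow_neg[of K.Y 1] by simp
  show "lam SD_a1 = a1K" "lam SD_a2 = a2K" "lam SD_b1 = K.b1" "lam SD_b2 = K.b2" "lam SD_B = K.B"
    by (simp_all add: SD_a1_def SD_a2_def SD_b1_def SD_b2_def SD_B_def lam_pow phi_u phi_v phi_B neg)
      (simp_all add: K.u_def K.v_def K.X_def K.Y_def K.word_simps)
qed

section \<open>Surjectivity onto the pure braid group\<close>

definition coset_rep :: "bool \<Rightarrow> braid_gen word set" where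
  "coset_rep e = (if e then sigmaK else \<one>\<^bsub>B2K\<^esub>)"

lemma coset_rep_closed [simp]: "coset_rep e \<in> carrier B2K"
  by (simp add: coset_rep_def)

text \<open>
  Right multiplication by a letter permutes the two cosets of the image of \<open>\<lambda>\<close>. For the letter
  \<open>\<sigma>\<close> or its inverse the coset changes, and the factor \<open>B\<^sup>\<plusminus>\<^sup>1\<close> appears exactly if the exponent of
  \<open>\<sigma>\<close> leaves \<open>{0, 1}\<close>.
\<close>

lemma coset_rep_step:
  "\<exists>q\<in>carrier SD. \<exists>e'. coset_rep e \<otimes>\<^bsub>B2K\<^esub> word_class klein_relations [l] =
    lam q \<otimes>\<^bsub>B2K\<^esub> coset_rep e'"
proof -
  obtain x b where l: "l = (x, b)" by (cases l)
  have letter: "word_class klein_relations [l] = (if b then g else inv\<^bsub>B2K\<^esub> g)"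
    if "g = gen_class klein_relations x" for g
    using that inv_gen_class[of klein_relations x] by (simp add: l gen_class_def B2K_def)
  have swap: "sigmaK \<otimes>\<^bsub>B2K\<^esub> a1K = K.b1 \<otimes>\<^bsub>B2K\<^esub> sigmaK" "sigmaK \<otimes>\<^bsub>B2K\<^esub> a2K = K.b2 \<otimes>\<^bsub>B2K\<^esub> sigmaK"
    by (simp_all add: K.b1_def K.b2_def K.word_simps)
  note swap' = swap K.conj_inv[OF swap(1)] K.conj_inv[OF swap(2)]
  show ?thesis
  proof (cases x)
    case Ga1
    have "coset_rep e \<otimes>\<^bsub>B2K\<^esub> word_class klein_relations [l] =
        lam (if b then (if e then SD_b1 else SD_a1) else inv\<^bsub>SD\<^esub> (if e then SD_b1 else SD_a1)) \<otimes>\<^bsub>B2K\<^esub> coset_rep e"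
      using Ga1 by (simp add: letter[of a1K] a1K_def[symmetric] coset_rep_def lam_values swap' del: SD_carrier)
    then show ?thesis
      by (intro bexI exI) (auto simp del: SD_carrier)
  next
    case Ga2
    have "coset_rep e \<otimes>\<^bsub>B2K\<^esub> word_class klein_relations [l] =
        lam (if b then (if e then SD_b2 else SD_a2) else inv\<^bsub>SD\<^esub> (if e then SD_b2 else SD_a2)) \<otimes>\<^bsub>B2K\<^esub> coset_rep e"
      using Ga2 by (simp add: letter[of a2K] a2K_def[symmetric] coset_rep_def lam_values swap' del: SD_carrier)
    then show ?thesis
      by (intro bexI exI) (auto simp del: SD_carrier)
  next
    case Gsigma
    have "coset_rep e \<otimes>\<^bsub>B2K\<^esub> word_class klein_relations [l] =
        lam (if e = b then (if e then SD_B else inv\<^bsub>SD\<^esub> SD_B) else \<one>\<^bsub>SD\<^esub>) \<otimes>\<^bsub>B2K\<^esub> coset_rep (\<not> e)"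
      using Gsigma
      by (simp add: letter[of sigmaK] sigmaK_def[symmetric] coset_rep_def lam_values K.B_def K.word_simps del: SD_carrier)
    then show ?thesis
      by (intro bexI exI) (auto simp del: SD_carrier)
  qed
qed

text \<open>
  Induction on a word from the right, with \<open>coset_rep_step\<close> for the last letter.
\<close>

lemma B2K_cosets:
  assumes "g \<in> carrier B2K"
  obtains p e where "p \<in> carrier SD" "g = lam p \<otimes>\<^bsub>B2K\<^esub> coset_rep e"
proof -
  have "\<exists>p\<in>carrier SD. \<exists>e. word_class klein_relations w = lam p \<otimes>\<^bsub>B2K\<^esub> coset_rep e" for w
  proof (induction w rule: rev_induct)
    case Nil
    have "word_class klein_relations [] = lam \<one>\<^bsub>SD\<^esub> \<otimes>\<^bsub>B2K\<^esub> coset_rep False"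
      by (simp add: coset_rep_def B2K_def one_presented_group[symmetric] del: SD_carrier)
        (simp add: K.l_one B2K_def[symmetric])
    then show ?case
      by blast
  next
    case (snoc l w)
    then obtain p e where p: "p \<in> carrier SD" "word_class klein_relations w = lam p \<otimes>\<^bsub>B2K\<^esub> coset_rep e"
      by blast
    obtain q e' where q: "q \<in> carrier SD"
      "coset_rep e \<otimes>\<^bsub>B2K\<^esub> word_class klein_relations [l] = lam q \<otimes>\<^bsub>B2K\<^esub> coset_rep e'"
      using coset_rep_step by blast
    have "word_class klein_relations (w @ [l]) =
        word_class klein_relations w \<otimes>\<^bsub>B2K\<^esub> word_class klein_relations [l]"
      by (simp add: B2K_def mult_presented_group)
    also have "\<dots> = lam p \<otimes>\<^bsub>B2K\<^esub> (coset_rep e \<otimes>\<^bsub>B2K\<^esub> word_class klein_relations [l])"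
      using p(1) word_class_in_carrier[of klein_relations "[l]"]
      by (simp add: p(2) K.m_assoc B2K_def[symmetric] del: SD_carrier)
    also have "\<dots> = lam (p \<otimes>\<^bsub>SD\<^esub> q) \<otimes>\<^bsub>B2K\<^esub> coset_rep e'"
      using p(1) q(1) by (simp add: q(2) K.m_assoc del: SD_carrier)
    finally show ?case
      using p(1) q(1) SD.m_closed by blast
  qed
  moreover obtain w where "g = word_class klein_relations w"
    using assms by (auto simp: B2K_def carrier_presented_group)
  ultimately show ?thesis
    using that by blast
qed

abbreviation "Z2 \<equiv> integer_mod_group 2"

lemma parity_hom: "braid_parity \<in> hom B2K Z2"
  and parity_a1: "braid_parity a1K = 0" and parity_a2: "braid_parity a2K = 0"
  and parity_sigma: "braid_parity sigmaK = 1"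
proof -
  interpret Z2: group Z2
    by simp
  let ?f = "\<lambda>x. if x = Gsigma then 1 else 0 :: int"
  have f: "range ?f \<subseteq> carrier Z2"
    by auto
  have R: "eval_word Z2 ?f l = eval_word Z2 ?f r" if "(l, r) \<in> klein_relations" for l r
    using that by (auto simp: klein_relations_explicit)
  show "braid_parity \<in> hom B2K Z2"
    unfolding braid_parity_def using Z2.pres_lift_hom[OF f R] by (simp only: B2K_def)
  show "braid_parity a1K = 0" "braid_parity a2K = 0" "braid_parity sigmaK = 1"
    unfolding braid_parity_def a1K_def a2K_def sigmaK_def
    by (simp_all only: Z2.pres_lift_gen_class[OF f R] simp_thms braid_gen.distinct if_True if_False)
qed

interpretation parity: group_hom B2K Z2 braid_parity
  using parity_hom by (simp add: group_hom_def group_hom_axioms_def K.is_group)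

lemma parity_lam:
  assumes "p \<in> carrier SD"
  shows "braid_parity (lam p) = 0"
proof -
  have b: "braid_parity K.b1 = 0" "braid_parity K.b2 = 0"
    by (simp_all add: K.b1_def K.b2_def parity_a1 parity_a2 parity_sigma)
  have gens: "(braid_parity \<circ> lam) q = 0"
    if "q \<in> {(uF, 0, 0), (vF, 0, 0), (\<one>\<^bsub>Fuv\<^esub>, 1, 0), (\<one>\<^bsub>Fuv\<^esub>, 0, 1)}" for q
    using that
    by (auto simp: lam_gens K.u_def K.v_def K.X_def K.Y_def b parity_a1 parity_a2)
  have "(braid_parity \<circ> lam) p = (\<lambda>_. 0) p"
  proof (rule hom_eq_on_generators[OF SD.is_group parity.H.is_group])
    show "braid_parity \<circ> lam \<in> hom SD Z2"
      by (rule hom_compose[OF lam_hom parity_hom])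
    show "(\<lambda>_. 0) \<in> hom SD Z2"
      by (simp add: hom_def)
    show "p \<in> generate SD {(uF, 0, 0), (vF, 0, 0), (\<one>\<^bsub>Fuv\<^esub>, 1, 0), (\<one>\<^bsub>Fuv\<^esub>, 0, 1)}"
      using assms by (simp only: generate_SD)
  qed (use gens in auto)
  then show ?thesis
    by simp
qed

section \<open>The automorphism induced by conjugation with \<sigma>\<close>

text \<open>
  Every braid is \<open>\<lambda>(p)\<close> or \<open>\<lambda>(p)\<sigma>\<close>, and the parity excludes the second form.
\<close>

lemma carrier_P2K: "carrier P2K = lam ` carrier SD"
proof
  show "lam ` carrier SD \<subseteq> carrier P2K"
    by (auto simp: P2K_def kernel_def parity_lam simp del: SD_carrier)
  show "carrier P2K \<subseteq> lam ` carrier SD"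
  proof
    fix g assume "g \<in> carrier P2K"
    then have g: "g \<in> carrier B2K" "braid_parity g = 0"
      by (auto simp: P2K_def kernel_def)
    obtain p e where p: "p \<in> carrier SD" "g = lam p \<otimes>\<^bsub>B2K\<^esub> coset_rep e"
      using B2K_cosets[OF g(1)] .
    have "\<not> e"
      using g(2) p(1) by (auto simp: p(2) coset_rep_def parity_lam parity_sigma simp del: SD_carrier)
    then show "g \<in> lam ` carrier SD"
      using p by (simp add: coset_rep_def del: SD_carrier)
  qed
qed

lemma lam_iso: "lam \<in> iso SD P2K"
proof -
  have "lam \<in> hom SD P2K"
  proof (rule homI)
    fix p q assume "p \<in> carrier SD" "q \<in> carrier SD"
    then show "lam (p \<otimes>\<^bsub>SD\<^esub> q) = lam p \<otimes>\<^bsub>P2K\<^esub> lam q"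
      by (simp add: P2K_def)
  qed (simp add: carrier_P2K del: SD_carrier)
  then show ?thesis
    using inj_lam by (simp add: iso_def bij_betw_def carrier_P2K)
qed

lemma lambda_iso_eq: "lambda_iso = restrict lam (carrier SD)"
  unfolding lambda_iso_def
proof (rule the_equality)
  have "restrict lam (carrier SD) \<in> iso SD P2K"
    using lam_iso SD.hom_restrict[of lam P2K "restrict lam (carrier SD)"]
    by (simp add: iso_def bij_betw_restrict_eq)
  then show "restrict lam (carrier SD) \<in> extensional (carrier SD) \<and>
      restrict lam (carrier SD) \<in> iso SD P2K \<and>
      restrict lam (carrier SD) (uF, 0, 0) = b1K \<otimes>\<^bsub>B2K\<^esub> b2K \<and>
      restrict lam (carrier SD) (vF, 0, 0) = inv\<^bsub>B2K\<^esub> b2K \<and>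
      restrict lam (carrier SD) (\<one>\<^bsub>Fuv\<^esub>, 1, 0) = b1K \<otimes>\<^bsub>B2K\<^esub> a1K \<otimes>\<^bsub>B2K\<^esub> b2K \<otimes>\<^bsub>B2K\<^esub> a2K \<and>
      restrict lam (carrier SD) (\<one>\<^bsub>Fuv\<^esub>, 0, 1) = inv\<^bsub>B2K\<^esub> a2K \<otimes>\<^bsub>B2K\<^esub> inv\<^bsub>B2K\<^esub> b2K"
    by (simp add: lam_gens K.u_def K.v_def K.X_def K.Y_def K_b)
next
  fix f assume f: "f \<in> extensional (carrier SD) \<and> f \<in> iso SD P2K \<and>
     f (uF, 0, 0) = b1K \<otimes>\<^bsub>B2K\<^esub> b2K \<and>
     f (vF, 0, 0) = inv\<^bsub>B2K\<^esub> b2K \<and>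
     f (\<one>\<^bsub>Fuv\<^esub>, 1, 0) = b1K \<otimes>\<^bsub>B2K\<^esub> a1K \<otimes>\<^bsub>B2K\<^esub> b2K \<otimes>\<^bsub>B2K\<^esub> a2K \<and>
     f (\<one>\<^bsub>Fuv\<^esub>, 0, 1) = inv\<^bsub>B2K\<^esub> a2K \<otimes>\<^bsub>B2K\<^esub> inv\<^bsub>B2K\<^esub> b2K"
  have f_hom: "f \<in> hom SD B2K"
    using f by (auto simp: iso_def hom_def P2K_def kernel_def)
  have f_gens: "f p = lam p"
    if "p \<in> {(uF, 0, 0), (vF, 0, 0), (\<one>\<^bsub>Fuv\<^esub>, 1, 0), (\<one>\<^bsub>Fuv\<^esub>, 0, 1)}" for p
    using that f by (auto simp: lam_gens K.u_def K.v_def K.X_def K.Y_def K_b)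
  have "f p = lam p" if "p \<in> carrier SD" for p
    using that
    by (intro hom_eq_on_generators[OF SD.is_group K.is_group f_hom lam_hom _ f_gens,
          where S = "{(uF, 0, 0), (vF, 0, 0), (\<one>\<^bsub>Fuv\<^esub>, 1, 0), (\<one>\<^bsub>Fuv\<^esub>, 0, 1)}"])
      (simp_all only: generate_SD, auto)
  with f show "f = restrict lam (carrier SD)"
    by (intro extensionalityI[of _ "carrier SD"]) (simp_all del: SD_carrier)
qed

lemma l_sigma_eqI:
  assumes p: "p \<in> carrier SD" and q: "q \<in> carrier SD"
    and eq: "sigmaK \<otimes>\<^bsub>B2K\<^esub> lam p = lam q \<otimes>\<^bsub>B2K\<^esub> sigmaK"
  shows "l_sigma p = q"
proof -
  have "c_sigma (lam p) = lam q"
    using p q by (simp add: c_sigma_def carrier_P2K eq K.m_assoc del: SD_carrier)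
  moreover have "inv_into (carrier SD) (restrict lam (carrier SD)) (restrict lam (carrier SD) q) = q"
    using inj_lam q by (intro inv_into_f_f) (simp_all add: inj_on_restrict_eq del: SD_carrier)
  ultimately show ?thesis
    using p q by (simp add: l_sigma_def gamma_iso_def lambda_iso_eq del: SD_carrier)
qed

theorem theorem24:
  fixes r s m n :: int
  shows
    "l_sigma (uF [^]\<^bsub>Fuv\<^esub> r, 0, 0) =
       ((BF \<otimes>\<^bsub>Fuv\<^esub> inv\<^bsub>Fuv\<^esub> uF) [^]\<^bsub>Fuv\<^esub> r \<otimes>\<^bsub>Fuv\<^esub> BF [^]\<^bsub>Fuv\<^esub> (- r), r, 0) \<and>
     l_sigma (vF [^]\<^bsub>Fuv\<^esub> s, 0, 0) =
       ((uF \<otimes>\<^bsub>Fuv\<^esub> vF) [^]\<^bsub>Fuv\<^esub> (- s) \<otimes>\<^bsub>Fuv\<^esub> (uF \<otimes>\<^bsub>Fuv\<^esub> BF) [^]\<^bsub>Fuv\<^esub> delta s, 0, s) \<and>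
     l_sigma (BF, 0, 0) = (BF, 0, 0) \<and>
     l_sigma (\<one>\<^bsub>Fuv\<^esub>, m, 0) = (\<one>\<^bsub>Fuv\<^esub>, m, 0) \<and>
     l_sigma (\<one>\<^bsub>Fuv\<^esub>, 0, n) = (BF [^]\<^bsub>Fuv\<^esub> delta n, 0, n)"
proof (intro conjI)
  note lam_eval = lam_pow phi_u phi_v phi_B phi.hom_int_pow
  show "l_sigma (uF [^]\<^bsub>Fuv\<^esub> r, 0, 0) =
      ((BF \<otimes>\<^bsub>Fuv\<^esub> inv\<^bsub>Fuv\<^esub> uF) [^]\<^bsub>Fuv\<^esub> r \<otimes>\<^bsub>Fuv\<^esub> BF [^]\<^bsub>Fuv\<^esub> (- r), r, 0)"
    by (rule l_sigma_eqI) (simp_all add: lam_eval K.s_u_pow)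
  show "l_sigma (vF [^]\<^bsub>Fuv\<^esub> s, 0, 0) =
      ((uF \<otimes>\<^bsub>Fuv\<^esub> vF) [^]\<^bsub>Fuv\<^esub> (- s) \<otimes>\<^bsub>Fuv\<^esub> (uF \<otimes>\<^bsub>Fuv\<^esub> BF) [^]\<^bsub>Fuv\<^esub> delta s, 0, s)"
    by (rule l_sigma_eqI) (simp_all add: lam_eval K.s_v_pow)
  show "l_sigma (BF, 0, 0) = (BF, 0, 0)"
    by (rule l_sigma_eqI) (simp_all add: lam_eval K.s_B)
  show "l_sigma (\<one>\<^bsub>Fuv\<^esub>, m, 0) = (\<one>\<^bsub>Fuv\<^esub>, m, 0)"
    by (rule l_sigma_eqI) (simp_all add: lam_eval K.conj_int_pow[OF K.s_X])
  show "l_sigma (\<one>\<^bsub>Fuv\<^esub>, 0, n) = (BF [^]\<^bsub>Fuv\<^esub> delta n, 0, n)"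
    by (rule l_sigma_eqI) (simp_all add: lam_eval K.s_Y_pow)
qed

end
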